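(* Let $(G,\mathfrak g,\|\cdot\|)$ be a Finsler Lie group with polyhedral norm. Then there exists $L>0$ such that all controls of normal curves in $G$ of length smaller than $L$ take values in a face.
   Context: A Finsler Lie group $(G,\mathfrak g,\|\cdot\|)$ is a Lie group $G$ with a norm $\|\cdot\|$ on its whole Lie algebra $\mathfrak g$. The norm is polyhedral if its closed unit ball is the convex hull of finitely many points. For an absolutely continuous curve $\gamma:I\to G$ on an interval $I$, the control is $u(t)=\mathrm dL_{\gamma(t)}^{-1}\dot\gamma(t)\in\mathfrak g$ ($L$ here denoting left translation), and its length is $\int_I\|u(t)\|\,\mathrm dt$. The energy is $\mathrm E:\mathfrak g\to\mathbb R$, $\mathrm E(v)=\frac12\|v\|^2$. The subdifferential of $\mathrm E$ at $w$ is $\partial_w\mathrm E=\{\eta\in \mathfrak g^*:\eta(v-w)\le \mathrm E(v)-\mathrm E(w)\ \forall v\in \mathfrak g\}$. An absolutely continuous curve $\gamma:I\to G$ with control $u\in L^2(I,\mathfrak g)$ is a normal curve if there exists $\lambda\in\mathfrak g^*$ with $\lambda\circ\mathrm{Ad}_{\gamma(t)}\in\partial_{u(t)}\mathrm E$ for a.e. $t\in I$. For $r>0$, a face of the sphere of radius $r$ in $\mathfrak g$ is a set of the form $\{v\in K:\eta(v)=\max_{w\in K}\eta(w)\}$, where $K=\{v\in \mathfrak g:\|v\|\le r\}$ and $\eta\in \mathfrak g^*\setminus\{0\}$. A measurable function $u:I\to \mathfrak g$ takes values in a face if there exist $r>0$ and a face $A$ of the sphere of radius $r$ such that $u(t)\in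 A$ for a.e. $t\in I$.
   Formalization: Curves of length zero (constant curves, and in particular dimension zero) are excluded: a constant curve is normal with control 0, but 0 lies in no face of a sphere of radius r > 0, so the claim as stated fails for it. *)

theory Defs
  imports "HOL-Analysis.Analysis" "HOL-Algebra.Group"
begin

section \<open>Smooth manifolds\<close>

text \<open>
  Only used for open sets \<open>S\<close>: a map is of class \<open>C^(k+1)\<close> iff it is differentiable and all its
  directional derivatives are of class \<open>C^k\<close>.
\<close>

primrec Ck_on :: "nat \<Rightarrow> ('a::real_normed_vector \<Rightarrow> 'b::real_normed_vector) \<Rightarrow> 'a set \<Rightarrow> bool" where
  "Ck_on 0 f S \<longleftrightarrow> continuous_on S f"
| "Ck_on (Suc k) f S \<longleftrightarrow>
     (\<forall>x\<in>S. f differentiable (at x)) \<and> (\<forall>v. Ck_on k (\<lambda>x. frechet_derivative f (at x) v) S)"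

definition smooth_on :: "('a::real_normed_vector \<Rightarrow> 'b::real_normed_vector) \<Rightarrow> 'a set \<Rightarrow> bool" where
  "smooth_on f S \<longleftrightarrow> (\<forall>k. Ck_on k f S)"

text \<open>A chart is a pair \<open>(U, \<phi>)\<close> of its domain and its coordinate map; outside \<open>U\<close> the values of
  \<open>\<phi>\<close> are irrelevant.\<close>

type_synonym ('a, 'e) chart = "'a set \<times> ('a \<Rightarrow> 'e)"

definition chart_inv :: "('a, 'e) chart \<Rightarrow> 'e \<Rightarrow> 'a" where
  "chart_inv c = inv_into (fst c) (snd c)"

locale smooth_manifold =
  fixes T :: "'a topology" and A :: "('a, 'e::euclidean_space) chart set"
  assumes hausdorff: "Hausdorff_space T"
    and second_countable: "second_countable T"
    and covering: "topspace T = (\<Union>c\<in>A. fst c)"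
    and chart_open: "(U, \<phi>) \<in> A \<Longrightarrow> openin T U \<and> open (\<phi> ` U)"
    and chart_homeomorphic:
      "(U, \<phi>) \<in> A \<Longrightarrow> homeomorphic_map (subtopology T U) (top_of_set (\<phi> ` U)) \<phi>"
    and compatible:
      "(U, \<phi>) \<in> A \<Longrightarrow> (V, \<psi>) \<in> A \<Longrightarrow> smooth_on (\<psi> \<circ> chart_inv (U, \<phi>)) (\<phi> ` (U \<inter> V))"

definition prod_atlas ::
  "('a, 'e) chart set \<Rightarrow> ('b, 'f) chart set \<Rightarrow> ('a \<times> 'b, 'e \<times> 'f) chart set" where
  "prod_atlas A B = {(U \<times> V, map_prod \<phi> \<psi>) | U \<phi> V \<psi>. (U, \<phi>) \<in> A \<and> (V, \<psi>) \<in> B}"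

definition smooth_map ::
  "'a topology \<Rightarrow> ('a, 'e::euclidean_space) chart set \<Rightarrow>
   'b topology \<Rightarrow> ('b, 'f::euclidean_space) chart set \<Rightarrow> ('a \<Rightarrow> 'b) \<Rightarrow> bool" where
  "smooth_map T A T' B f \<longleftrightarrow> continuous_map T T' f \<and>
     (\<forall>(U, \<phi>)\<in>A. \<forall>(V, \<psi>)\<in>B. smooth_on (\<psi> \<circ> f \<circ> chart_inv (U, \<phi>)) (\<phi> ` (U \<inter> f -` V)))"

text \<open>
  At every point \<open>p\<close> one chart \<open>chart_at A p\<close> of the atlas is selected once and for all, and the
  tangent space at \<open>p\<close> is identified with the model space \<open>'e\<close> through the differential of that
  chart. Velocities and differentials are expressed with respect to these identifications; another
  selection changes them by linear isomorphisms.
\<close>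

definition chart_at :: "('a, 'e) chart set \<Rightarrow> 'a \<Rightarrow> ('a, 'e) chart" where
  "chart_at A p = (SOME c. c \<in> A \<and> p \<in> fst c)"

definition tangent_map ::
  "('a, 'e::euclidean_space) chart set \<Rightarrow> ('b, 'f::euclidean_space) chart set \<Rightarrow>
   ('a \<Rightarrow> 'b) \<Rightarrow> 'a \<Rightarrow> 'e \<Rightarrow> 'f" where
  "tangent_map A B f p =
     frechet_derivative (snd (chart_at B (f p)) \<circ> f \<circ> chart_inv (chart_at A p))
       (at (snd (chart_at A p) p))"

definition has_velocity ::
  "('a, 'e::euclidean_space) chart set \<Rightarrow> (real \<Rightarrow> 'a) \<Rightarrow> real set \<Rightarrow> real \<Rightarrow> 'e \<Rightarrow> bool" where
  "has_velocity A \<gamma> I t v \<longleftrightarrow>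
     ((\<lambda>s. snd (chart_at A (\<gamma> t)) (\<gamma> s)) has_vector_derivative v) (at t within I)"


section \<open>Absolutely continuous curves\<close>

text \<open>\<open>D\<close> ranges over the finite families of non-overlapping compact intervals contained in \<open>S\<close>;
  an interval \<open>J\<close> has the end points \<open>Inf J\<close> and \<open>Sup J\<close>.\<close>

definition abs_continuous_on :: "real set \<Rightarrow> (real \<Rightarrow> 'e::real_normed_vector) \<Rightarrow> bool" where
  "abs_continuous_on S f \<longleftrightarrow>
     (\<forall>\<epsilon>>0. \<exists>\<delta>>0. \<forall>D. D division_of \<Union>D \<and> \<Union>D \<subseteq> S \<and> (\<Sum>J\<in>D. Sup J - Inf J) < \<delta> \<longrightarrow>
        (\<Sum>J\<in>D. norm (f (Sup J) - f (Inf J))) < \<epsilon>)"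

text \<open>On a non-compact interval this is the absolute continuity on every compact subinterval.\<close>

definition abs_continuous_curve ::
  "'a topology \<Rightarrow> ('a, 'e::euclidean_space) chart set \<Rightarrow> real set \<Rightarrow> (real \<Rightarrow> 'a) \<Rightarrow> bool" where
  "abs_continuous_curve T A I \<gamma> \<longleftrightarrow> continuous_map (top_of_set I) T \<gamma> \<and>
     (\<forall>(U, \<phi>)\<in>A. \<forall>a b. {a..b} \<subseteq> I \<and> \<gamma> ` {a..b} \<subseteq> U \<longrightarrow> abs_continuous_on {a..b} (\<phi> \<circ> \<gamma>))"


section \<open>Finsler Lie groups\<close>

locale lie_group = group G + smooth_manifold T A
  for G :: "('a, 'm) monoid_scheme" (structure)
    and T :: "'a topology" and A :: "('a, 'e::euclidean_space) chart set" +
  assumes carrier: "topspace T = carrier G"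
    and smooth_mult: "smooth_map (prod_topology T T) (prod_atlas A A) T A (\<lambda>(x, y). x \<otimes> y)"
    and smooth_inv: "smooth_map T A T A (\<lambda>x. inv x)"

text \<open>\<open>N\<close> is a norm on the Lie algebra, that is, on the tangent space at the identity,
  which is identified with \<open>'e\<close>.\<close>

locale finsler_lie_group = lie_group G T A
  for G :: "('a, 'm) monoid_scheme" (structure)
    and T :: "'a topology" and A :: "('a, 'e::euclidean_space) chart set" +
  fixes N :: "'e \<Rightarrow> real"
  assumes norm_eq_0: "N v = 0 \<longleftrightarrow> v = 0"
    and norm_scale: "N (a *\<^sub>R v) = \<bar>a\<bar> * N v"
    and norm_triangle: "N (v + w) \<le> N v + N w"

definition polyhedral_norm :: "('e::euclidean_space \<Rightarrow> real) \<Rightarrow> bool" where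
  "polyhedral_norm N \<longleftrightarrow> polytope {v. N v \<le> 1}"

definition Ad :: "('a, 'm) monoid_scheme \<Rightarrow> ('a, 'e::euclidean_space) chart set \<Rightarrow> 'a \<Rightarrow> 'e \<Rightarrow> 'e" where
  "Ad G A g = tangent_map A A (\<lambda>x. g \<otimes>\<^bsub>G\<^esub> x \<otimes>\<^bsub>G\<^esub> inv\<^bsub>G\<^esub> g) \<one>\<^bsub>G\<^esub>"

text \<open>\<open>u(t)\<close> is the image of the velocity of \<open>\<gamma>\<close> at \<open>t\<close> under the differential at \<open>\<gamma>(t)\<close> of the
  inverse of the left translation by \<open>\<gamma>(t)\<close>, for almost every \<open>t\<close>.\<close>

definition has_control ::
  "('a, 'm) monoid_scheme \<Rightarrow> ('a, 'e::euclidean_space) chart set \<Rightarrow> real set \<Rightarrow>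
   (real \<Rightarrow> 'a) \<Rightarrow> (real \<Rightarrow> 'e) \<Rightarrow> bool" where
  "has_control G A I \<gamma> u \<longleftrightarrow>
     (AE t in lebesgue_on I. \<exists>v. has_velocity A \<gamma> I t v \<and>
        u t = tangent_map A A (\<lambda>x. inv\<^bsub>G\<^esub> (\<gamma> t) \<otimes>\<^bsub>G\<^esub> x) (\<gamma> t) v)"

definition curve_length :: "('e::euclidean_space \<Rightarrow> real) \<Rightarrow> real set \<Rightarrow> (real \<Rightarrow> 'e) \<Rightarrow> ennreal" where
  "curve_length N I u = (\<integral>\<^sup>+t. ennreal (N (u t)) \<partial>lebesgue_on I)"


section \<open>Normal curves and faces\<close>

definition energy :: "('e \<Rightarrow> real) \<Rightarrow> 'e \<Rightarrow> real" where
  "energy N v = 1 / 2 * (N v)\<^sup>2"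

definition subdifferential :: "('e::real_vector \<Rightarrow> real) \<Rightarrow> 'e \<Rightarrow> ('e \<Rightarrow> real) set" where
  "subdifferential E w = {\<eta>. linear \<eta> \<and> (\<forall>v. \<eta> (v - w) \<le> E v - E w)}"

definition L2_control :: "('e::euclidean_space \<Rightarrow> real) \<Rightarrow> real set \<Rightarrow> (real \<Rightarrow> 'e) \<Rightarrow> bool" where
  "L2_control N I u \<longleftrightarrow>
     u \<in> borel_measurable (lebesgue_on I) \<and> integrable (lebesgue_on I) (\<lambda>t. (N (u t))\<^sup>2)"

definition normal_curve ::
  "('a, 'm) monoid_scheme \<Rightarrow> 'a topology \<Rightarrow> ('a, 'e::euclidean_space) chart set \<Rightarrow> ('e \<Rightarrow> real) \<Rightarrow>
   real set \<Rightarrow> (real \<Rightarrow> 'a) \<Rightarrow> (real \<Rightarrow> 'e) \<Rightarrow> bool" where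
  "normal_curve G T A N I \<gamma> u \<longleftrightarrow>
     abs_continuous_curve T A I \<gamma> \<and> has_control G A I \<gamma> u \<and> L2_control N I u \<and>
     (\<exists>l :: 'e \<Rightarrow> real. linear l \<and>
        (AE t in lebesgue_on I. l \<circ> Ad G A (\<gamma> t) \<in> subdifferential (energy N) (u t)))"

text \<open>Since \<open>r > 0\<close> and \<open>\<eta> \<noteq> 0\<close>, the maximum of \<open>\<eta>\<close> is positive and no face contains \<open>0\<close>; the zero
  control of a constant curve therefore takes values in no face.\<close>

definition sphere_face :: "('e::euclidean_space \<Rightarrow> real) \<Rightarrow> real \<Rightarrow> 'e set \<Rightarrow> bool" where
  "sphere_face N r F \<longleftrightarrow>
     (\<exists>\<eta> :: 'e \<Rightarrow> real. linear \<eta> \<and> \<eta> \<noteq> (\<lambda>_. 0) \<and>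
        F = {v. N v \<le> r \<and> (\<forall>w. N w \<le> r \<longrightarrow> \<eta> w \<le> \<eta> v)})"

definition takes_values_in_face ::
  "('e::euclidean_space \<Rightarrow> real) \<Rightarrow> real set \<Rightarrow> (real \<Rightarrow> 'e) \<Rightarrow> bool" where
  "takes_values_in_face N I u \<longleftrightarrow>
     (\<exists>r>0. \<exists>F. sphere_face N r F \<and> (AE t in lebesgue_on I. u t \<in> F))"

end

theory Submission
  imports Defs
begin

text \<open>
  Let \<open>\<gamma>\<close> be a normal curve with control \<open>u\<close> and covector \<open>\<lambda>\<close>, and let \<open>V\<close> be a finite set whose
  convex hull is the unit ball. The covector \<open>\<eta>\<^sub>t = \<lambda> \<circ> Ad\<^bsub>\<gamma>(t)\<^esub>\<close> is studied through
  its finitely many values \<open>\<eta>\<^sub>t(v)\<close> for \<open>v \<in> V\<close> (\<open>momentum\<close>). Membership in the subdifferential of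
  the energy says that \<open>\<eta>\<^sub>t(u(t)) = \<parallel>u(t)\<parallel>\<^sup>2\<close> and that the dual norm of \<open>\<eta>\<^sub>t\<close>, which is the
  maximum of \<open>\<eta>\<^sub>t\<close> over \<open>V\<close>, equals \<open>\<parallel>u(t)\<parallel>\<close>; hence \<open>u(t) / \<parallel>u(t)\<parallel>\<close> is a convex combination of
  those \<open>v \<in> V\<close> at which \<open>\<eta>\<^sub>t\<close> is maximal, the active ones.

  Each momentum is locally absolutely continuous and satisfies
  \<open>d/dt \<eta>\<^sub>t(v) = \<eta>\<^sub>t([u(t), v])\<close> almost everywhere (\<open>Ad_curve_abs_continuous\<close>,
  \<open>Ad_curve_derivative\<close>). The bracket is obtained as the derivative of the adjoint map at the
  identity; that it vanishes on the diagonal expresses the symmetry of the second derivative of the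
  multiplication in a chart at the identity (\<open>local_adjoint_derivative\<close>).

  The speed is constant: at almost every \<open>t\<close> all active momenta have the same derivative, because two
  functions can agree with different derivatives only at isolated points; averaging over the convex
  combination that represents \<open>u(t)\<close>, this common derivative is a multiple of
  \<open>\<eta>\<^sub>t([u(t), u(t)]) = 0\<close>. So the maximum has derivative \<open>0\<close> almost everywhere, and being
  absolutely continuous it is a constant \<open>r\<close> (\<open>dual_norm_constant\<close>).

  If \<open>C\<close> bounds the bracket, then the momenta at unit vectors have derivative at most \<open>C r\<^sup>2\<close>, while
  the length of the curve is \<open>r\<close> times that of its interval. The normalised covectors \<open>\<eta>\<^sub>t / r\<close>
  therefore vary by at most \<open>C\<close> times the length of \<open>\<gamma>\<close> (\<open>momentum_variation\<close>), and every \<open>v\<close> that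
  is active at some time is nearly maximal for one fixed covector \<open>\<eta>\<^sub>s / r\<close>. By compactness of the
  dual ball there is a threshold \<open>\<delta>\<close>, depending on the norm only, below which nearly maximal points of
  one covector are exactly maximal for another one (\<open>near_maximisers_exact\<close>). That other covector
  exposes a face containing almost all values of \<open>u\<close>, and \<open>L = \<delta> / C\<close> works.
\<close>

section \<open>Absolutely continuous functions\<close>

lemma Sup_Inf_division_interval:
  fixes D :: "real set set"
  assumes "D division_of S" "k \<in> D"
  obtains p q where "k = {p..q}" "p \<le> q" "Inf k = p" "Sup k = q"
proof -
  obtain p q where "k = cbox p q" using cbox_division_memE assms by metis
  moreover have "k \<noteq> {}" using assms by (auto simp: division_of_def)
  ultimately show ?thesis using that by auto
qed

lemma open_cover_of_negligible:
  fixes S :: "'e::euclidean_space set"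
  assumes S: "negligible S" and \<delta>: "\<delta> > 0"
  obtains T where "open T" "S \<subseteq> T" "T \<in> lmeasurable" "measure lebesgue T < \<delta>"
proof -
  have S': "S \<in> sets lebesgue" "S \<in> lmeasurable" "measure lebesgue S = 0"
    using S by (simp_all add: negligible_imp_sets negligible_imp_measurable negligible_imp_measure0)
  obtain T where T: "open T" "S \<subseteq> T" "T - S \<in> lmeasurable" "emeasure lebesgue (T - S) < ennreal \<delta>"
    using sets_lebesgue_outer_open[OF S'(1) \<delta>] by blast
  have *: "T = (T - S) \<union> S" using T(2) by auto
  have meas: "T \<in> lmeasurable"
    using fmeasurable.Un[OF T(3) S'(2)] * by simp
  have "measure lebesgue T \<le> measure lebesgue (T - S) + measure lebesgue S"
    using measure_Un_le[of "T - S" lebesgue S] T(3) S'(1) * by (simp add: fmeasurableD)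
  also have "measure lebesgue (T - S) < \<delta>"
    using T(3,4) \<delta> by (simp add: emeasure_eq_measure2 ennreal_less_iff)
  finally show ?thesis using that T meas S'(3) by simp
qed

text \<open>
  Derivative bounds integrate to increments for absolutely continuous functions. Take a tagged division that is fine for a gauge adapted to \<open>g\<close>, to the
  slope bound, and to an open set of small measure around the exceptional set \<open>S\<close>. Intervals tagged
  outside \<open>S\<close> contribute at most a Riemann sum of \<open>g + \<epsilon>\<close>; those tagged in \<open>S\<close> have small total
  length and are controlled by absolute continuity.
\<close>

lemma abs_continuous_increment_le:
  fixes f :: "real \<Rightarrow> 'e::real_normed_vector"
  assumes ac: "abs_continuous_on {a..b} f" and ab: "a \<le> b" and S: "negligible S"
    and g: "(g has_integral i) {a..b}" and g0: "\<And>t. t \<in> {a..b} \<Longrightarrow> 0 \<le> g t"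
    and slope: "\<And>t \<epsilon>. t \<in> {a..b} - S \<Longrightarrow> \<epsilon> > 0 \<Longrightarrow>
      \<exists>d>0. \<forall>s\<in>{a..b}. \<bar>s - t\<bar> < d \<longrightarrow> norm (f s - f t) \<le> (g t + \<epsilon>) * \<bar>s - t\<bar>"
  shows "norm (f b - f a) \<le> i"
proof -
  have main: "norm (f b - f a) \<le> i + \<epsilon> * (2 + (b - a))" if \<epsilon>: "\<epsilon> > 0" for \<epsilon>
  proof -
    obtain \<delta> where \<delta>: "\<delta> > 0"
      and acD: "\<forall>D. D division_of \<Union>D \<and> \<Union>D \<subseteq> {a..b} \<and> (\<Sum>J\<in>D. Sup J - Inf J) < \<delta> \<longrightarrow>
        (\<Sum>J\<in>D. norm (f (Sup J) - f (Inf J))) < \<epsilon>"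
      using ac[unfolded abs_continuous_on_def, rule_format, OF \<epsilon>] by blast
    obtain T where T: "open T" "S \<subseteq> T" "T \<in> lmeasurable" "measure lebesgue T < \<delta>"
      using open_cover_of_negligible[OF S \<delta>] by blast
    obtain \<gamma>1 where \<gamma>1: "gauge \<gamma>1" and hk: "\<forall>p. p tagged_division_of {a..b} \<and> \<gamma>1 fine p \<longrightarrow>
        norm ((\<Sum>(x,k)\<in>p. measure lborel k *\<^sub>R g x) - i) < \<epsilon>"
      using g[unfolded has_integral_real, rule_format, OF \<epsilon>] by blast
    have "\<forall>t\<in>{a..b} - S. \<exists>d>0. \<forall>s\<in>{a..b}. \<bar>s - t\<bar> < d \<longrightarrow>
        norm (f s - f t) \<le> (g t + \<epsilon>) * \<bar>s - t\<bar>"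
      using slope \<epsilon> by blast
    then obtain d0 where d0: "\<forall>t\<in>{a..b} - S. d0 t > 0 \<and> (\<forall>s\<in>{a..b}. \<bar>s - t\<bar> < d0 t \<longrightarrow>
        norm (f s - f t) \<le> (g t + \<epsilon>) * \<bar>s - t\<bar>)"
      by (rule bchoice[THEN exE]) blast
    define d where "d t = (if t \<in> {a..b} - S then d0 t else 1)" for t
    have d: "d t > 0" for t using d0 by (auto simp: d_def)
    have slope': "norm (f s - f t) \<le> (g t + \<epsilon>) * \<bar>s - t\<bar>"
      if "t \<in> {a..b} - S" "s \<in> {a..b}" "\<bar>s - t\<bar> < d t" for s t
      using d0 that by (auto simp: d_def)
    define \<gamma>2 where "\<gamma>2 t = (if t \<in> S then T else ball t (d t))" for t
    have "gauge \<gamma>2" using T d by (auto simp: gauge_def \<gamma>2_def)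
    then have "gauge (\<lambda>x. \<gamma>1 x \<inter> \<gamma>2 x)" using \<gamma>1 by blast
    then obtain p where p: "p tagged_division_of {a..b}" and fine: "\<gamma>1 fine p" "\<gamma>2 fine p"
      using fine_division_exists_real fine_Int by metis
    have fin: "finite p" using p by blast
    have pk: "\<exists>l r. k = {l..r} \<and> l \<le> x \<and> x \<le> r \<and> a \<le> l \<and> r \<le> b" if "(x,k) \<in> p" for x k
      using tagged_division_ofD(2-4)[OF p that] by (fastforce simp: subset_iff)
    define p0 where "p0 = {(x,k)\<in>p. x \<in> S}"
    have p0: "p0 \<subseteq> p" by (auto simp: p0_def)
    have p0': "p0 tagged_division_of \<Union>(snd ` p0)"
      using tagged_partial_division_of_Union_self tagged_partial_division_subset p p0
      by (metis tagged_division_of_def)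
    define D where "D = snd ` p0"
    have D: "D division_of \<Union>D" unfolding D_def using p0' by (rule division_of_tagged_division)
    have DT: "\<Union>D \<subseteq> T"
      using fine(2) by (fastforce simp: D_def p0_def \<gamma>2_def fine_def)
    have Dab: "\<Union>D \<subseteq> {a..b}" using pk by (fastforce simp: D_def p0_def)
    have len: "Sup k - Inf k = measure lebesgue k" if k: "k \<in> D" for k
    proof -
      obtain p q where "k = {p..q}" "p \<le> q" "Inf k = p" "Sup k = q"
        by (rule Sup_Inf_division_interval[OF D k])
      then show ?thesis by simp
    qed
    have "(\<Sum>J\<in>D. Sup J - Inf J) = (\<Sum>J\<in>D. measure lebesgue J)" using len by simp
    also have "\<dots> = measure lebesgue (\<Union>D)"
      using content_division[OF D] by simp
    also have "\<dots> \<le> measure lebesgue T"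
      using T DT lmeasurable_division[OF D] by (intro measure_mono_fmeasurable) (simp_all add: fmeasurableD)
    finally have small: "(\<Sum>J\<in>D. Sup J - Inf J) < \<delta>" using T by simp
    \<comment> \<open>The value at the empty interval is set to 0 to pass from a sum over tags to one over intervals.\<close>
    define dist_ends where "dist_ends k = (if k = {} then 0 else norm (f (Sup k) - f (Inf k)))" for k
    have "(\<Sum>(x,k)\<in>p0. norm (f (Sup k) - f (Inf k))) = (\<Sum>(x,k)\<in>p0. dist_ends k)"
      by (intro sum.cong) (auto simp: dist_ends_def dest: tagged_division_ofD(2)[OF p0'])
    also have "\<dots> = (\<Sum>J\<in>D. dist_ends J)"
      unfolding D_def
      by (rule sum.over_tagged_division_lemma[OF p0'])
         (auto simp: box_real dist_ends_def dest!: antisym)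
    also have "\<dots> = (\<Sum>J\<in>D. norm (f (Sup J) - f (Inf J)))"
      using division_ofD(3)[OF D] by (intro sum.cong) (auto simp: dist_ends_def)
    also have "\<dots> < \<epsilon>" using acD D Dab small by blast
    finally have bad: "(\<Sum>(x,k)\<in>p0. norm (f (Sup k) - f (Inf k))) < \<epsilon>" .
    have good1: "norm (f (Sup k) - f (Inf k)) \<le> (g x + \<epsilon>) * measure lborel k" if xk: "(x,k) \<in> p - p0" for x k
    proof -
      obtain l r where k: "k = {l..r}" "l \<le> x" "x \<le> r" "a \<le> l" "r \<le> b" using pk xk by blast
      have x: "x \<in> {a..b} - S" using xk k by (auto simp: p0_def)
      have "k \<subseteq> ball x (d x)" using fine(2) xk x by (fastforce simp: fine_def \<gamma>2_def)
      moreover have "l \<in> k" "r \<in> k" using k by auto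
      ultimately have "l \<in> ball x (d x)" "r \<in> ball x (d x)" by auto
      then have "\<bar>l - x\<bar> < d x" "\<bar>r - x\<bar> < d x" by (auto simp: dist_real_def)
      then have "norm (f l - f x) \<le> (g x + \<epsilon>) * (x - l)" "norm (f r - f x) \<le> (g x + \<epsilon>) * (r - x)"
        using slope'[OF x, of l] slope'[OF x, of r] k by auto
      moreover have "norm (f r - f l) \<le> norm (f r - f x) + norm (f l - f x)"
        using norm_triangle_ineq4[of "f r - f x" "f l - f x"] by simp
      ultimately show ?thesis using k by (simp add: algebra_simps)
    qed
    have good: "(\<Sum>(x,k)\<in>p-p0. norm (f (Sup k) - f (Inf k))) \<le> (\<Sum>(x,k)\<in>p-p0. (g x + \<epsilon>) * measure lborel k)"
      using good1 by (intro sum_mono) auto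
    have "(\<Sum>(x,k)\<in>p-p0. (g x + \<epsilon>) * measure lborel k) \<le> (\<Sum>(x,k)\<in>p. (g x + \<epsilon>) * measure lborel k)"
    proof (rule sum_mono2[OF fin])
      fix z assume "z \<in> p - (p - p0)"
      then obtain x k where "z = (x,k)" "(x,k) \<in> p" by (cases z) auto
      moreover have "x \<in> {a..b}" using pk[OF \<open>(x,k) \<in> p\<close>] by auto
      ultimately show "0 \<le> (case z of (x, k) \<Rightarrow> (g x + \<epsilon>) * measure lborel k)"
        using g0[of x] \<epsilon> by auto
    qed auto
    also have "\<dots> = (\<Sum>(x,k)\<in>p. measure lborel k *\<^sub>R g x) + \<epsilon> * (\<Sum>(x,k)\<in>p. measure lborel k)"
      by (simp add: sum_distrib_left sum.distrib[symmetric] case_prod_unfold algebra_simps)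
    also have "(\<Sum>(x,k)\<in>p. measure lborel k) = b - a"
      using additive_content_tagged_division[of p a b] p ab by simp
    also have "(\<Sum>(x,k)\<in>p. measure lborel k *\<^sub>R g x) \<le> i + \<epsilon>"
      using hk[rule_format, of p] p fine(1) by (simp add: abs_less_iff)
    finally have good': "(\<Sum>(x,k)\<in>p-p0. (g x + \<epsilon>) * measure lborel k) \<le> i + \<epsilon> + \<epsilon> * (b - a)" by simp
    have "norm (f b - f a) = norm (\<Sum>(x,k)\<in>p. f (Sup k) - f (Inf k))"
      using additive_tagged_division_1[OF ab p, of f] by simp
    also have "\<dots> \<le> (\<Sum>(x,k)\<in>p. norm (f (Sup k) - f (Inf k)))"
      by (rule order_trans[OF norm_sum]) (simp add: case_prod_unfold)
    also have "\<dots> = (\<Sum>(x,k)\<in>p-p0. norm (f (Sup k) - f (Inf k))) + (\<Sum>(x,k)\<in>p0. norm (f (Sup k) - f (Inf k)))"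
      by (rule sum.subset_diff[OF p0 fin])
    finally show ?thesis using bad good good' by (simp add: algebra_simps)
  qed
  have "norm (f b - f a) \<le> i + e" if "e > 0" for e
  proof -
    have "e / (2 + (b - a)) * (2 + (b - a)) = e" using ab by simp
    then show ?thesis using main[of "e / (2 + (b - a))"] that ab by simp
  qed
  then show ?thesis using field_le_epsilon by blast
qed

text \<open>
  With one function this covers Lipschitz images, with several it covers their maximum.
\<close>

lemma abs_continuous_on_dominated:
  fixes f :: "'i \<Rightarrow> real \<Rightarrow> 'e::real_normed_vector" and F :: "real \<Rightarrow> 'f::real_normed_vector"
  assumes V: "finite V" and f: "\<And>v. v \<in> V \<Longrightarrow> abs_continuous_on S (f v)"
    and le: "\<And>s t. s \<in> S \<Longrightarrow> t \<in> S \<Longrightarrow> norm (F s - F t) \<le> K * (\<Sum>v\<in>V. norm (f v s - f v t))"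
  shows "abs_continuous_on S F"
  unfolding abs_continuous_on_def
proof (intro allI impI)
  fix \<epsilon> :: real assume \<epsilon>: "\<epsilon> > 0"
  define K' where "K' = \<bar>K\<bar> + 1"
  define \<epsilon>' where "\<epsilon>' = \<epsilon> / (K' * (card V + 1))"
  have K': "K' > 0" "K \<le> K'" by (auto simp: K'_def)
  have \<epsilon>': "\<epsilon>' > 0" using \<epsilon> K' by (simp add: \<epsilon>'_def)
  have "\<forall>v\<in>V. \<exists>\<delta>>0. \<forall>D. D division_of \<Union>D \<and> \<Union>D \<subseteq> S \<and> (\<Sum>J\<in>D. Sup J - Inf J) < \<delta> \<longrightarrow>
        (\<Sum>J\<in>D. norm (f v (Sup J) - f v (Inf J))) < \<epsilon>'"
    using f \<epsilon>' unfolding abs_continuous_on_def by blast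
  then obtain \<delta> where \<delta>: "\<forall>v\<in>V. \<delta> v > 0 \<and> (\<forall>D. D division_of \<Union>D \<and> \<Union>D \<subseteq> S \<and>
      (\<Sum>J\<in>D. Sup J - Inf J) < \<delta> v \<longrightarrow> (\<Sum>J\<in>D. norm (f v (Sup J) - f v (Inf J))) < \<epsilon>')"
    by (rule bchoice[THEN exE]) blast
  define \<delta>0 where "\<delta>0 = Min (insert 1 (\<delta> ` V))"
  have \<delta>0: "\<delta>0 > 0" "\<And>v. v \<in> V \<Longrightarrow> \<delta>0 \<le> \<delta> v" using V \<delta> by (auto simp: \<delta>0_def)
  show "\<exists>\<delta>>0. \<forall>D. D division_of \<Union>D \<and> \<Union>D \<subseteq> S \<and> (\<Sum>J\<in>D. Sup J - Inf J) < \<delta> \<longrightarrow>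
        (\<Sum>J\<in>D. norm (F (Sup J) - F (Inf J))) < \<epsilon>"
  proof (intro exI[of _ \<delta>0] conjI allI impI \<delta>0(1))
    fix D assume D: "D division_of \<Union>D \<and> \<Union>D \<subseteq> S \<and> (\<Sum>J\<in>D. Sup J - Inf J) < \<delta>0"
    have "(\<Sum>J\<in>D. norm (F (Sup J) - F (Inf J))) \<le> (\<Sum>J\<in>D. K' * (\<Sum>v\<in>V. norm (f v (Sup J) - f v (Inf J))))"
    proof (rule sum_mono)
      fix J assume J: "J \<in> D"
      have div: "D division_of \<Union>D" using D by blast
      obtain p q where pq: "J = {p..q}" "p \<le> q" "Inf J = p" "Sup J = q"
        using Sup_Inf_division_interval[OF div J] by metis
      then have "p \<in> J" "q \<in> J" by auto
      then have "Sup J \<in> S" "Inf J \<in> S" using D J pq(3,4) by auto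
      then have "norm (F (Sup J) - F (Inf J)) \<le> K * (\<Sum>v\<in>V. norm (f v (Sup J) - f v (Inf J)))"
        by (rule le)
      also have "\<dots> \<le> K' * (\<Sum>v\<in>V. norm (f v (Sup J) - f v (Inf J)))"
        using K' by (intro mult_right_mono sum_nonneg) auto
      finally show "norm (F (Sup J) - F (Inf J)) \<le> \<dots>" .
    qed
    also have "\<dots> = K' * (\<Sum>v\<in>V. \<Sum>J\<in>D. norm (f v (Sup J) - f v (Inf J)))"
      by (simp add: sum_distrib_left[symmetric] sum.swap[of _ D])
    also have "\<dots> \<le> K' * (\<Sum>v\<in>V. \<epsilon>')"
    proof (intro mult_left_mono sum_mono)
      fix v assume v: "v \<in> V"
      then have "(\<Sum>J\<in>D. Sup J - Inf J) < \<delta> v" using D \<delta>0(2)[of v] by linarith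
      then show "(\<Sum>J\<in>D. norm (f v (Sup J) - f v (Inf J))) \<le> \<epsilon>'"
        using \<delta> v D by (simp add: less_imp_le)
    qed (use K' in simp)
    also have "\<dots> < \<epsilon>"
    proof -
      have "K' * (\<Sum>v\<in>V. \<epsilon>') = \<epsilon> * (card V / (card V + 1))"
      proof -
        have "K' * (n * (\<epsilon> / (K' * (n + 1)))) = \<epsilon> * (n / (n + 1))" if "n \<ge> 0" for n :: real
          using K'(1) that by (simp add: divide_simps)
        from this[of "card V"] show ?thesis using K'(1) by (simp add: \<epsilon>'_def)
      qed
      also have "\<dots> < \<epsilon> * 1" using \<epsilon> by (intro mult_strict_left_mono) simp_all
      finally show ?thesis by simp
    qed
    finally show "(\<Sum>J\<in>D. norm (F (Sup J) - F (Inf J))) < \<epsilon>" .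
  qed
qed

text \<open>
  By the Lindelof property countably many of the isolating balls already cover \<open>Z\<close>, and each of them
  contains one point of \<open>Z\<close>.
\<close>

lemma countable_isolated_points:
  fixes Z :: "real set"
  assumes "\<And>t. t \<in> Z \<Longrightarrow> \<exists>d>0. \<forall>s\<in>Z. \<bar>s - t\<bar> < d \<longrightarrow> s = t"
  shows "countable Z"
proof -
  obtain d where d: "\<And>t. t \<in> Z \<Longrightarrow> d t > 0" "\<And>t s. t \<in> Z \<Longrightarrow> s \<in> Z \<Longrightarrow> \<bar>s - t\<bar> < d t \<Longrightarrow> s = t"
    using assms by metis
  obtain C where C: "C \<subseteq> Z" "countable C" "(\<Union>t\<in>Z. ball t (d t)) = (\<Union>t\<in>C. ball t (d t))"
  proof -
    obtain \<F> where \<F>: "\<F> \<subseteq> (\<lambda>t. ball t (d t)) ` Z" "countable \<F>" "\<Union>\<F> = (\<Union>t\<in>Z. ball t (d t))"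
      using Lindelof[of "(\<lambda>t. ball t (d t)) ` Z"] by auto
    obtain C where "C \<subseteq> Z" "countable C" "\<F> = (\<lambda>t. ball t (d t)) ` C"
      using countable_subset_image[of \<F> "\<lambda>t. ball t (d t)" Z] \<F>(1,2) by blast
    then show ?thesis using that[of C] \<F>(3) by simp
  qed
  have "Z \<subseteq> C"
  proof
    fix t assume "t \<in> Z"
    then obtain c where "c \<in> C" "t \<in> ball c (d c)" using C d by (metis UN_iff centre_in_ball)
    then show "t \<in> C" using d(2)[of c t] C \<open>t \<in> Z\<close> by (auto simp: dist_real_def abs_minus_commute)
  qed
  then show ?thesis using C countable_subset by blast
qed

section \<open>Twice continuously differentiable maps\<close>

lemma Ck_on_subset: "Ck_on k f S \<Longrightarrow> T \<subseteq> S \<Longrightarrow> Ck_on k f T"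
  by (induction k arbitrary: f) (auto intro: continuous_on_subset)

lemma Ck_on_cong:
  assumes "Ck_on k f S" "open S" "\<And>x. x \<in> S \<Longrightarrow> f x = g x"
  shows "Ck_on k g S"
  using assms(1,3)
proof (induction k arbitrary: f g)
  case 0
  then show ?case using continuous_on_cong by fastforce
next
  case (Suc k)
  have deriv: "(g has_derivative frechet_derivative f (at x)) (at x)" if "x \<in> S" for x
    using Suc.prems that assms(2) has_derivative_transform_within_open[of f _ x UNIV S g]
    by (auto simp: frechet_derivative_works)
  then have eq: "frechet_derivative f (at x) = frechet_derivative g (at x)" if "x \<in> S" for x
    using that frechet_derivative_at by blast
  have "Ck_on k (\<lambda>x. frechet_derivative g (at x) v) S" for v
    using Suc.IH[of "\<lambda>x. frechet_derivative f (at x) v" "\<lambda>x. frechet_derivative g (at x) v"] Suc.prems(1) eq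
    by simp
  then show ?case using deriv by (auto intro: differentiableI)
qed

text \<open>
  Continuity of the finitely many partial derivatives bounds the differential on a small ball, and the
  mean value inequality applies there.
\<close>

lemma Ck_on_Suc_lipschitz:
  fixes f :: "'a::euclidean_space \<Rightarrow> 'b::real_normed_vector"
  assumes f: "Ck_on (Suc k) f S" and S: "open S" and p: "p \<in> S"
  obtains r K where "r > 0" "K \<ge> 0" "ball p r \<subseteq> S"
    "\<And>x y. x \<in> ball p r \<Longrightarrow> y \<in> ball p r \<Longrightarrow> norm (f x - f y) \<le> K * norm (x - y)"
proof -
  let ?D = "\<lambda>x. frechet_derivative f (at x)"
  have cont: "continuous_on S (\<lambda>x. ?D x v)" for v
  proof (cases k)
    case (Suc l)
    then have "\<forall>x\<in>S. (\<lambda>x. ?D x v) differentiable (at x)" using f by auto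
    then show ?thesis
      by (auto intro!: continuous_at_imp_continuous_on simp: differentiable_imp_continuous_within)
  qed (use f in auto)
  define M where "M i = norm (?D p i) + 1" for i
  have "\<forall>\<^sub>F x in nhds p. norm (?D x i) < M i" for i
  proof -
    have "((\<lambda>x. norm (?D x i)) \<longlongrightarrow> norm (?D p i)) (at p)"
      using cont S p by (intro tendsto_norm) (auto simp: continuous_on_eq_continuous_at isCont_def)
    then have "\<forall>\<^sub>F x in at p. norm (?D x i) < M i"
      by (rule order_tendstoD) (simp add: M_def)
    then show ?thesis by (auto simp: eventually_at_filter M_def elim!: eventually_mono)
  qed
  then have "\<forall>\<^sub>F x in nhds p. \<forall>i\<in>Basis. norm (?D x i) < M i"
    by (intro eventually_ball_finite) auto
  moreover have "\<forall>\<^sub>F x in nhds p. x \<in> S" using S p by (rule eventually_nhds_in_open)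
  ultimately have "\<forall>\<^sub>F x in nhds p. (\<forall>i\<in>Basis. norm (?D x i) < M i) \<and> x \<in> S"
    by (rule eventually_conj)
  then obtain r where r: "r > 0" "\<And>x. dist x p < r \<Longrightarrow> (\<forall>i\<in>Basis. norm (?D x i) < M i) \<and> x \<in> S"
    unfolding eventually_nhds_metric by blast
  define K where "K = (\<Sum>i\<in>Basis. M i)"
  have K: "K \<ge> 0" by (auto simp: K_def M_def intro!: sum_nonneg)
  have der: "(f has_derivative ?D x) (at x)" if "x \<in> ball p r" for x
    using f r(2)[of x] that by (auto simp: dist_commute frechet_derivative_works)
  have on: "onorm (?D x) \<le> K" if x: "x \<in> ball p r" for x
  proof (rule onorm_bound[OF K])
    fix h
    have lin: "linear (?D x)" using der[OF x] has_derivative_linear by blast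
    have "?D x h = ?D x (\<Sum>i\<in>Basis. (h \<bullet> i) *\<^sub>R i)" by (simp add: euclidean_representation)
    also have "\<dots> = (\<Sum>i\<in>Basis. (h \<bullet> i) *\<^sub>R ?D x i)"
      using lin by (simp add: linear_sum linear_cmul)
    also have "norm \<dots> \<le> (\<Sum>i\<in>Basis. norm h * M i)"
    proof (rule sum_norm_le)
      fix i :: 'a assume i: "i \<in> Basis"
      have "norm (?D x i) \<le> M i" using r(2)[of x] x i by (auto simp: dist_commute less_imp_le)
      then show "norm ((h \<bullet> i) *\<^sub>R ?D x i) \<le> norm h * M i"
        using i by (auto intro!: mult_mono simp: Basis_le_norm)
    qed
    finally show "norm (?D x h) \<le> K * norm h" by (simp add: K_def sum_distrib_left mult.commute)
  qed
  show ?thesis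
  proof (rule that[of r K])
    show "ball p r \<subseteq> S" using r(2) by (auto simp: dist_commute)
    show "norm (f x - f y) \<le> K * norm (x - y)" if "x \<in> ball p r" "y \<in> ball p r" for x y
    proof (rule differentiable_bound[of "ball p r" f ?D])
      show "(f has_derivative ?D z) (at z within ball p r)" if "z \<in> ball p r" for z
        using der[OF that] by (rule has_derivative_at_withinI)
    qed (use that in \<open>auto intro: on\<close>)
  qed (use r K in auto)
qed

lemma C2_derivative_lipschitz:
  fixes f :: "'a::euclidean_space \<Rightarrow> 'b::real_normed_vector"
  assumes f: "Ck_on 2 f S" and S: "open S" and p: "p \<in> S"
  obtains r K where "r > 0" "K \<ge> 0" "ball p r \<subseteq> S"
    "\<And>x y v. x \<in> ball p r \<Longrightarrow> y \<in> ball p r \<Longrightarrow>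
      norm (frechet_derivative f (at x) v - frechet_derivative f (at y) v) \<le> K * norm (x - y) * norm v"
proof -
  let ?D = "\<lambda>x. frechet_derivative f (at x)"
  have f2: "Ck_on (Suc (Suc 0)) f S" using f by (simp add: numeral_2_eq_2)
  have "\<exists>r K. r > 0 \<and> K \<ge> 0 \<and> ball p r \<subseteq> S \<and>
      (\<forall>x\<in>ball p r. \<forall>y\<in>ball p r. norm (?D x i - ?D y i) \<le> K * norm (x - y))" for i
  proof -
    have C1: "Ck_on (Suc 0) (\<lambda>x. ?D x i) S" using f2 by simp
    obtain r K where "r > 0" "K \<ge> 0" "ball p r \<subseteq> S"
      "\<And>x y. x \<in> ball p r \<Longrightarrow> y \<in> ball p r \<Longrightarrow> norm (?D x i - ?D y i) \<le> K * norm (x - y)"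
      using Ck_on_Suc_lipschitz[OF C1 S p] by metis
    then show ?thesis by blast
  qed
  then have "\<forall>i. \<exists>r K. r > 0 \<and> K \<ge> 0 \<and> ball p r \<subseteq> S \<and>
      (\<forall>x\<in>ball p r. \<forall>y\<in>ball p r. norm (?D x i - ?D y i) \<le> K * norm (x - y))" by blast
  from choice[OF this] obtain r where "\<forall>i. \<exists>K. r i > 0 \<and> K \<ge> 0 \<and> ball p (r i) \<subseteq> S \<and>
      (\<forall>x\<in>ball p (r i). \<forall>y\<in>ball p (r i). norm (?D x i - ?D y i) \<le> K * norm (x - y))" by blast
  from choice[OF this] obtain K where rK: "\<And>i. r i > 0" "\<And>i. K i \<ge> 0" "\<And>i. ball p (r i) \<subseteq> S"
    "\<And>i x y. x \<in> ball p (r i) \<Longrightarrow> y \<in> ball p (r i) \<Longrightarrow> norm (?D x i - ?D y i) \<le> K i * norm (x - y)"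
    by blast
  define r0 where "r0 = Min (r ` Basis)"
  define K0 where "K0 = (\<Sum>i\<in>Basis. K i)"
  have r0: "r0 > 0" "\<And>i. i \<in> Basis \<Longrightarrow> r0 \<le> r i" using rK(1) by (auto simp: r0_def)
  have sub: "ball p r0 \<subseteq> ball p (r i)" if "i \<in> Basis" for i using r0(2)[OF that] by auto
  have sub': "ball p r0 \<subseteq> S" using sub rK(3) nonempty_Basis by blast
  show ?thesis
  proof (rule that[of r0 K0])
    show "K0 \<ge> 0" using rK by (auto simp: K0_def intro: sum_nonneg)
    fix x y v assume xy: "x \<in> ball p r0" "y \<in> ball p r0"
    have "x \<in> S" "y \<in> S" using xy sub' by auto
    then have lin: "linear (?D x)" "linear (?D y)" using f2 by (auto intro: linear_frechet_derivative)
    have "?D x v - ?D y v = ?D x (\<Sum>i\<in>Basis. (v \<bullet> i) *\<^sub>R i) - ?D y (\<Sum>i\<in>Basis. (v \<bullet> i) *\<^sub>R i)"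
      by (simp add: euclidean_representation)
    also have "\<dots> = (\<Sum>i\<in>Basis. (v \<bullet> i) *\<^sub>R (?D x i - ?D y i))"
      using lin by (simp add: linear_sum linear_cmul sum_subtractf scaleR_diff_right)
    also have "norm \<dots> \<le> (\<Sum>i\<in>Basis. norm v * (K i * norm (x - y)))"
    proof (rule sum_norm_le)
      fix i :: 'a assume i: "i \<in> Basis"
      have "norm (?D x i - ?D y i) \<le> K i * norm (x - y)" using rK(4) sub[OF i] xy by blast
      then show "norm ((v \<bullet> i) *\<^sub>R (?D x i - ?D y i)) \<le> norm v * (K i * norm (x - y))"
        using i by (auto intro!: mult_mono simp: Basis_le_norm)
    qed
    finally show "norm (?D x v - ?D y v) \<le> K0 * norm (x - y) * norm v"
      by (simp add: K0_def sum_distrib_left sum_distrib_right mult_ac)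
  qed (use r0 sub' in auto)
qed

text \<open>
  Along \<open>\<tau> \<mapsto> f (p + \<tau> v + s w) - f (p + \<tau> v)\<close> the derivative is \<open>s G w\<close> up to \<open>o(s)\<close>, so the mean
  value inequality on \<open>[0, s]\<close> gives the estimate. The second difference is symmetric in \<open>v\<close> and \<open>w\<close>;
  that makes this the key to the symmetry of second derivatives.
\<close>

lemma second_difference_approx:
  fixes f :: "'a::real_normed_vector \<Rightarrow> 'b::real_normed_vector"
  assumes S: "open S" "p \<in> S" and f: "\<And>z. z \<in> S \<Longrightarrow> f differentiable (at z)"
    and G: "((\<lambda>z. frechet_derivative f (at z) v) has_derivative G) (at p)" and \<epsilon>: "\<epsilon> > 0"
  shows "\<exists>d>0. \<forall>s. 0 < s \<and> s < d \<longrightarrow>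
    norm (f (p + s *\<^sub>R v + s *\<^sub>R w) - f (p + s *\<^sub>R v) - f (p + s *\<^sub>R w) + f p - s\<^sup>2 *\<^sub>R G w) \<le> \<epsilon> * s\<^sup>2"
proof -
  let ?D = "\<lambda>z. frechet_derivative f (at z)"
  define K where "K = norm v + norm w + 1"
  define \<epsilon>' where "\<epsilon>' = \<epsilon> / (2 * K)"
  have K: "K > 0" by (simp add: K_def add_nonneg_pos)
  have \<epsilon>': "\<epsilon>' > 0" using \<epsilon> K by (simp add: \<epsilon>'_def)
  have bl: "bounded_linear G" using G by (rule has_derivative_bounded_linear)
  obtain d1 where d1: "d1 > 0"
    "\<And>y. norm (y - p) < d1 \<Longrightarrow> norm (?D y v - ?D p v - G (y - p)) \<le> \<epsilon>' * norm (y - p)"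
    using G \<epsilon>' unfolding has_derivative_at_alt by blast
  obtain d2 where d2: "d2 > 0" "ball p d2 \<subseteq> S" using S openE by blast
  \<comment> \<open>All points that occur are at distance at most \<open>s K\<close> from \<open>p\<close>.\<close>
  define d where "d = min d1 d2 / K"
  have d: "d > 0" using d1 d2 K by (simp add: d_def)
  show ?thesis
  proof (intro exI[of _ d] conjI d allI impI)
    fix s :: real assume s: "0 < s \<and> s < d"
    then have sK: "s * K < min d1 d2" using K by (simp add: d_def field_simps)
    define \<psi> where "\<psi> \<tau> = f (p + \<tau> *\<^sub>R v + s *\<^sub>R w) - f (p + \<tau> *\<^sub>R v) - \<tau> *\<^sub>R s *\<^sub>R G w" for \<tau>
    define c where "c \<tau> = ?D (p + \<tau> *\<^sub>R v + s *\<^sub>R w) v - ?D (p + \<tau> *\<^sub>R v) v - s *\<^sub>R G w" for \<tau>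
    have near: "norm (\<tau> *\<^sub>R v + \<sigma> *\<^sub>R w) \<le> s * K" if "0 \<le> \<tau>" "\<tau> \<le> s" "0 \<le> \<sigma>" "\<sigma> \<le> s" for \<tau> \<sigma>
    proof -
      have "norm (\<tau> *\<^sub>R v + \<sigma> *\<^sub>R w) \<le> \<tau> * norm v + \<sigma> * norm w"
        using norm_triangle_ineq[of "\<tau> *\<^sub>R v" "\<sigma> *\<^sub>R w"] that by simp
      also have "\<dots> \<le> s * norm v + s * norm w"
        using that by (intro add_mono mult_right_mono) auto
      also have "\<dots> \<le> s * K" using s by (simp add: K_def algebra_simps)
      finally show ?thesis .
    qed
    have diff: "(f has_derivative ?D (p + \<tau> *\<^sub>R v + \<sigma> *\<^sub>R w)) (at (p + \<tau> *\<^sub>R v + \<sigma> *\<^sub>R w))"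
      if "0 \<le> \<tau>" "\<tau> \<le> s" "0 \<le> \<sigma>" "\<sigma> \<le> s" for \<tau> \<sigma>
    proof -
      have "dist p (p + \<tau> *\<^sub>R v + \<sigma> *\<^sub>R w) = norm (\<tau> *\<^sub>R v + \<sigma> *\<^sub>R w)"
      proof -
        have "(p + \<tau> *\<^sub>R v + \<sigma> *\<^sub>R w) - p = \<tau> *\<^sub>R v + \<sigma> *\<^sub>R w" by simp
        then show ?thesis by (metis dist_commute dist_norm)
      qed
      also have "\<dots> < d2" using near[OF that] sK by simp
      finally have "p + \<tau> *\<^sub>R v + \<sigma> *\<^sub>R w \<in> S" using d2 by auto
      then show ?thesis using f frechet_derivative_works by blast
    qed
    have der: "(\<psi> has_derivative (\<lambda>h. h *\<^sub>R c \<tau>)) (at \<tau> within {0..s})" if \<tau>: "\<tau> \<in> {0..s}" for \<tau>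
    proof -
      have D1: "((\<lambda>\<tau>. f (p + \<tau> *\<^sub>R v + \<sigma> *\<^sub>R w)) has_derivative (\<lambda>h. h *\<^sub>R ?D (p + \<tau> *\<^sub>R v + \<sigma> *\<^sub>R w) v)) (at \<tau>)"
        if "0 \<le> \<sigma>" "\<sigma> \<le> s" for \<sigma>
      proof -
        have lin: "linear (?D (p + \<tau> *\<^sub>R v + \<sigma> *\<^sub>R w))"
          using diff[of \<tau> \<sigma>] \<tau> that has_derivative_linear by auto
        have "((\<lambda>\<tau>. p + \<tau> *\<^sub>R v + \<sigma> *\<^sub>R w) has_derivative (\<lambda>h. h *\<^sub>R v)) (at \<tau>)"
          by (auto intro!: derivative_eq_intros)
        from has_derivative_compose[OF this diff] show ?thesis
          using \<tau> that linear_cmul[OF lin] by simp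
      qed
      have "((\<lambda>\<tau>. f (p + \<tau> *\<^sub>R v)) has_derivative (\<lambda>h. h *\<^sub>R ?D (p + \<tau> *\<^sub>R v) v)) (at \<tau>)"
        using D1[of 0] s by simp
      moreover have "((\<lambda>\<tau>. \<tau> *\<^sub>R s *\<^sub>R G w) has_derivative (\<lambda>h. h *\<^sub>R s *\<^sub>R G w)) (at \<tau>)"
        by (auto intro!: derivative_eq_intros)
      moreover have "((\<lambda>\<tau>. f (p + \<tau> *\<^sub>R v + s *\<^sub>R w)) has_derivative (\<lambda>h. h *\<^sub>R ?D (p + \<tau> *\<^sub>R v + s *\<^sub>R w) v)) (at \<tau>)"
        using D1[of s] s by simp
      ultimately have "(\<psi> has_derivative (\<lambda>h. h *\<^sub>R ?D (p + \<tau> *\<^sub>R v + s *\<^sub>R w) v - h *\<^sub>R ?D (p + \<tau> *\<^sub>R v) v - h *\<^sub>R s *\<^sub>R G w)) (at \<tau>)"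
        unfolding \<psi>_def by (intro has_derivative_diff)
      from has_derivative_at_withinI[OF this] show ?thesis by (simp add: c_def scaleR_diff_right)
    qed
    have cb: "norm (c \<tau>) \<le> \<epsilon> * s" if \<tau>: "\<tau> \<in> {0..s}" for \<tau>
    proof -
      define E where "E y = ?D y v - ?D p v - G (y - p)" for y
      have E: "norm (E (p + \<tau> *\<^sub>R v + \<sigma> *\<^sub>R w)) \<le> \<epsilon>' * (s * K)" if "0 \<le> \<sigma>" "\<sigma> \<le> s" for \<sigma>
      proof -
        have n: "norm ((p + \<tau> *\<^sub>R v + \<sigma> *\<^sub>R w) - p) \<le> s * K" using near[of \<tau> \<sigma>] \<tau> that
          by (simp add: add.assoc)
        then have "norm (E (p + \<tau> *\<^sub>R v + \<sigma> *\<^sub>R w)) \<le> \<epsilon>' * norm ((p + \<tau> *\<^sub>R v + \<sigma> *\<^sub>R w) - p)"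
          unfolding E_def using sK by (intro d1(2)) linarith
        also have "\<dots> \<le> \<epsilon>' * (s * K)" using n \<epsilon>' by (intro mult_left_mono) auto
        finally show ?thesis .
      qed
      have "G (\<tau> *\<^sub>R v + s *\<^sub>R w) - G (\<tau> *\<^sub>R v) = s *\<^sub>R G w"
        using bl by (simp add: linear_simps)
      then have "c \<tau> = E (p + \<tau> *\<^sub>R v + s *\<^sub>R w) - E (p + \<tau> *\<^sub>R v + 0 *\<^sub>R w)"
        by (simp add: c_def E_def algebra_simps)
      also have "norm \<dots> \<le> \<epsilon>' * (s * K) + \<epsilon>' * (s * K)"
        using s by (intro norm_triangle_le_diff[OF add_mono] E) auto
      also have "\<dots> = \<epsilon> * s" using K by (simp add: \<epsilon>'_def)
      finally show ?thesis .
    qed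
    have "norm (\<psi> s - \<psi> 0) \<le> \<epsilon> * s * norm (s - 0)"
    proof (rule differentiable_bound[OF _ der])
      show "onorm (\<lambda>h. h *\<^sub>R c \<tau>) \<le> \<epsilon> * s" if "\<tau> \<in> {0..s}" for \<tau>
        using cb[OF that] s \<epsilon> by (intro onorm_bound) (auto intro!: mult_left_mono simp: mult.commute)
    qed (use s in auto)
    moreover have "\<psi> s - \<psi> 0 = f (p + s *\<^sub>R v + s *\<^sub>R w) - f (p + s *\<^sub>R v) - f (p + s *\<^sub>R w) + f p - s\<^sup>2 *\<^sub>R G w"
      by (simp add: \<psi>_def power2_eq_square)
    ultimately show "norm (f (p + s *\<^sub>R v + s *\<^sub>R w) - f (p + s *\<^sub>R v) - f (p + s *\<^sub>R w) + f p - s\<^sup>2 *\<^sub>R G w) \<le> \<epsilon> * s\<^sup>2"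
      using s by (simp add: power2_eq_square)
  qed
qed

text \<open>
  Young's theorem: both mixed derivatives are limits of the same second difference divided by \<open>s\<^sup>2\<close>.
\<close>

lemma symmetric_second_derivative:
  fixes f :: "'a::real_normed_vector \<Rightarrow> 'b::real_normed_vector"
  assumes S: "open S" "p \<in> S" and f: "\<And>z. z \<in> S \<Longrightarrow> f differentiable (at z)"
    and G: "((\<lambda>z. frechet_derivative f (at z) v) has_derivative G) (at p)"
    and H: "((\<lambda>z. frechet_derivative f (at z) w) has_derivative H) (at p)"
  shows "G w = H v"
proof -
  have "norm (G w - H v) \<le> 0 + \<epsilon>" if \<epsilon>: "\<epsilon> > 0" for \<epsilon>
  proof -
    define \<Delta> where "\<Delta> s = f (p + s *\<^sub>R v + s *\<^sub>R w) - f (p + s *\<^sub>R v) - f (p + s *\<^sub>R w) + f p" for s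
    obtain d1 where d1: "d1 > 0" "\<And>s. 0 < s \<Longrightarrow> s < d1 \<Longrightarrow> norm (\<Delta> s - s\<^sup>2 *\<^sub>R G w) \<le> \<epsilon> / 2 * s\<^sup>2"
      using second_difference_approx[OF S f G, of "\<epsilon> / 2" w] \<epsilon> unfolding \<Delta>_def by auto
    obtain d2 where d2: "d2 > 0" "\<And>s. 0 < s \<Longrightarrow> s < d2 \<Longrightarrow>
        norm (f (p + s *\<^sub>R w + s *\<^sub>R v) - f (p + s *\<^sub>R w) - f (p + s *\<^sub>R v) + f p - s\<^sup>2 *\<^sub>R H v) \<le> \<epsilon> / 2 * s\<^sup>2"
      using second_difference_approx[OF S f H, of "\<epsilon> / 2" v] \<epsilon> by auto
    define s where "s = min d1 d2 / 2"
    have s: "0 < s" "s < d1" "s < d2" using d1(1) d2(1) by (auto simp: s_def min_def)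
    have "f (p + s *\<^sub>R w + s *\<^sub>R v) - f (p + s *\<^sub>R w) - f (p + s *\<^sub>R v) + f p = \<Delta> s"
      by (simp add: \<Delta>_def algebra_simps)
    then have 2: "norm (\<Delta> s - s\<^sup>2 *\<^sub>R H v) \<le> \<epsilon> / 2 * s\<^sup>2" using d2(2)[of s] s by simp
    have "s\<^sup>2 * norm (G w - H v) = norm ((\<Delta> s - s\<^sup>2 *\<^sub>R H v) - (\<Delta> s - s\<^sup>2 *\<^sub>R G w))"
      by (simp flip: scaleR_diff_right)
    also have "\<dots> \<le> \<epsilon> / 2 * s\<^sup>2 + \<epsilon> / 2 * s\<^sup>2"
      using 2 d1(2)[of s] s by (intro norm_triangle_le_diff[OF add_mono]) auto
    also have "\<dots> = s\<^sup>2 * \<epsilon>" by simp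
    finally show ?thesis using s by simp
  qed
  then have "norm (G w - H v) \<le> 0" by (rule field_le_epsilon)
  then show ?thesis by simp
qed

section \<open>The derivative of the adjoint action in coordinates\<close>

lemma has_derivative_zero_quadratic:
  fixes E :: "'a::real_normed_vector \<Rightarrow> 'b::real_normed_vector"
  assumes "r > 0" and E: "\<And>x. x \<in> ball e r \<Longrightarrow> norm (E x) \<le> K * (norm (x - e))\<^sup>2"
  shows "(E has_derivative (\<lambda>h. 0)) (at e)"
  unfolding has_derivative_at_alt
proof (intro conjI allI impI)
  fix \<epsilon> :: real assume \<epsilon>: "\<epsilon> > 0"
  have "E e = 0" using E[of e] \<open>r > 0\<close> by simp
  define d where "d = min r (\<epsilon> / (\<bar>K\<bar> + 1))"
  have d: "d > 0" using \<epsilon> \<open>r > 0\<close> by (simp add: d_def)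
  show "\<exists>d>0. \<forall>y. norm (y - e) < d \<longrightarrow> norm (E y - E e - 0) \<le> \<epsilon> * norm (y - e)"
  proof (intro exI[of _ d] conjI d allI impI)
    fix y assume y: "norm (y - e) < d"
    then have "y \<in> ball e r" by (simp add: d_def dist_norm norm_minus_commute)
    then have "norm (E y) \<le> K * norm (y - e) * norm (y - e)"
      using E[of y] by (simp add: power2_eq_square mult.assoc)
    also have "\<dots> \<le> \<epsilon> * norm (y - e)"
    proof (intro mult_right_mono)
      have "K * norm (y - e) \<le> (\<bar>K\<bar> + 1) * norm (y - e)" by (intro mult_right_mono) auto
      also have "\<dots> \<le> (\<bar>K\<bar> + 1) * (\<epsilon> / (\<bar>K\<bar> + 1))" using y by (intro mult_left_mono) (auto simp: d_def)
      also have "\<dots> = \<epsilon>" by simp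
      finally show "K * norm (y - e) \<le> \<epsilon>" .
    qed simp
    finally show "norm (E y - E e - 0) \<le> \<epsilon> * norm (y - e)" using \<open>E e = 0\<close> by simp
  qed
qed simp

text \<open>
  Here \<open>m\<close> is a multiplication in a chart around the neutral element \<open>e\<close>, and \<open>a x\<close> plays the role of
  the adjoint map: the relation between \<open>a\<close> and \<open>m\<close> is the differential of \<open>(x y x\<^sup>-\<^sup>1) x = x y\<close> with
  respect to \<open>y\<close>. It reads \<open>R x (a x v) = P x v\<close>, where \<open>R x\<close> and \<open>P x\<close> are the differentials of the
  right and left translations by \<open>x\<close>. Both are Lipschitz in \<open>x\<close> and equal to the identity at \<open>e\<close>, so
  \<open>R x\<close> is invertible with a uniform bound near \<open>e\<close>, and \<open>a\<close> inherits their regularity: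
  \<open>a x v = v + (P x v - R x v)\<close> up to second order. Thus \<open>B h v\<close> is the difference of the two mixed
  second derivatives of \<open>m\<close>, which is the Lie bracket, and on the diagonal it vanishes because these
  derivatives are equal.
\<close>

lemma local_adjoint_derivative:
  fixes m :: "'e::euclidean_space \<times> 'e \<Rightarrow> 'e" and a :: "'e \<Rightarrow> 'e \<Rightarrow> 'e"
  assumes S: "open S" "(e, e) \<in> S" and C2: "Ck_on 2 m S"
    and unit: "\<forall>\<^sub>F x in nhds e. m (x, e) = x" "\<forall>\<^sub>F x in nhds e. m (e, x) = x"
    and lin: "\<forall>\<^sub>F x in nhds e. linear (a x)"
    and eq: "\<forall>\<^sub>F x in nhds e. \<forall>v. frechet_derivative m (at (e, x)) (a x v, 0)
       = frechet_derivative m (at (x, e)) (0, v)"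
  obtains B r K where "bilinear B" "\<And>w. B w w = 0"
    "\<And>v. ((\<lambda>x. a x v) has_derivative (\<lambda>h. B h v)) (at e)"
    "r > 0" "\<And>x y v. x \<in> ball e r \<Longrightarrow> y \<in> ball e r \<Longrightarrow> norm (a x v - a y v) \<le> K * norm (x - y) * norm v"
proof -
  let ?D = "\<lambda>z. frechet_derivative m (at z)"
  define R where "R x u = ?D (e, x) (u, 0)" for x u
  define P where "P x v = ?D (x, e) (0, v)" for x v
  have C2': "Ck_on (Suc (Suc 0)) m S" using C2 by (simp add: numeral_2_eq_2)
  have diff: "m differentiable (at z)" "linear (?D z)" if "z \<in> S" for z
    using C2' that by (auto intro: linear_frechet_derivative)
  have hder: "(m has_derivative ?D z) (at z)" if "z \<in> S" for z
    using diff(1)[OF that] by (simp add: frechet_derivative_works)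
  obtain r1 K where r1: "r1 > 0" "K \<ge> 0" "ball (e, e) r1 \<subseteq> S"
    and lip: "\<And>x y v. x \<in> ball (e, e) r1 \<Longrightarrow> y \<in> ball (e, e) r1 \<Longrightarrow> norm (?D x v - ?D y v) \<le> K * norm (x - y) * norm v"
    by (rule C2_derivative_lipschitz[OF C2 S], rule that)
  obtain r2 where r2: "r2 > 0" "\<And>x v. dist x e < r2 \<Longrightarrow> linear (a x) \<and> R x (a x v) = P x v"
    using eventually_conj[OF lin eq] unfolding eventually_nhds_metric R_def P_def by blast
  \<comment> \<open>The last bound makes \<open>R x\<close> differ from the identity by at most \<open>1/2\<close>.\<close>
  define r where "r = Min {r1, r2, 1 / (2 * (K + 1))}"
  have r: "r > 0" "r \<le> r1" "r \<le> r2" "r \<le> 1 / (2 * (K + 1))" using r1 r2 by (auto simp: r_def)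
  have rK: "K * r \<le> 1 / 2"
  proof -
    have "K * r \<le> (K + 1) * (1 / (2 * (K + 1)))" using r r1 by (intro mult_mono) auto
    also have "\<dots> = 1 / 2" using r1 by (simp add: divide_simps)
    finally show ?thesis .
  qed
  have e: "e \<in> ball e r" using r by simp
  have inb: "(e, x) \<in> ball (e, e) r1" "(x, e) \<in> ball (e, e) r1" if "x \<in> ball e r" for x
    using that r by (auto simp: dist_Pair_Pair)
  have Rlip: "norm (R x u - R y u) \<le> K * norm (x - y) * norm u"
    and Plip: "norm (P x u - P y u) \<le> K * norm (x - y) * norm u"
    if "x \<in> ball e r" "y \<in> ball e r" for x y u
    using lip[of "(e, x)" "(e, y)" "(u, 0)"] lip[of "(x, e)" "(y, e)" "(0, u)"] inb that
    by (auto simp: R_def P_def norm_Pair)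
  have linR: "linear (R x)" and linP: "linear (P x)" if "x \<in> ball e r" for x
  proof -
    have "(e, x) \<in> S" "(x, e) \<in> S" using inb[OF that] r1 by auto
    note L = this[THEN diff(2)]
    have "linear (\<lambda>u::'e. (u, 0::'e))" "linear (\<lambda>u::'e. (0::'e, u))" by (auto intro!: linearI)
    from linear_compose[OF this(1) L(1)] linear_compose[OF this(2) L(2)]
    show "linear (R x)" "linear (P x)" by (simp_all add: R_def[abs_def] P_def[abs_def] o_def)
  qed
  have Re: "R e u = u" and Pe: "P e u = u" for u
  proof -
    have 1: "((\<lambda>x. m (x, e)) has_derivative (\<lambda>u. R e u)) (at e)"
      unfolding R_def using S
      by (intro has_derivative_compose[of "\<lambda>x. (x, e)" "\<lambda>u. (u, 0)" e UNIV m, OF _ hder])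
         (auto intro!: derivative_eq_intros)
    have 2: "((\<lambda>x. m (e, x)) has_derivative (\<lambda>u. P e u)) (at e)"
      unfolding P_def using S
      by (intro has_derivative_compose[of "\<lambda>x. (e, x)" "\<lambda>u. (0, u)" e UNIV m, OF _ hder])
         (auto intro!: derivative_eq_intros)
    have id: "((\<lambda>x. x) has_derivative (\<lambda>u. u)) (at e)" by (auto intro!: derivative_eq_intros)
    have m: "m (e, e) = e" using eventually_nhds_x_imp_x[OF unit(1)] by simp
    have "((\<lambda>x. m (x, e)) has_derivative (\<lambda>u. u)) (at e)"
    proof (rule has_derivative_transform_eventually[OF id])
      show "\<forall>\<^sub>F x in at e. x = m (x, e)"
        using unit(1) by (auto simp: eventually_at_filter elim!: eventually_mono)
    qed (use m in auto)
    from has_derivative_unique[OF 1 this] show "R e u = u" by meson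
    have "((\<lambda>x. m (e, x)) has_derivative (\<lambda>u. u)) (at e)"
    proof (rule has_derivative_transform_eventually[OF id])
      show "\<forall>\<^sub>F x in at e. x = m (e, x)"
        using unit(2) by (auto simp: eventually_at_filter elim!: eventually_mono)
    qed (use m in auto)
    from has_derivative_unique[OF 2 this] show "P e u = u" by meson
  qed
  have aeq: "R x (a x v) = P x v" and alin: "linear (a x)" if "x \<in> ball e r" for x v
    using r2(2)[of x] that r by (auto simp: dist_commute)
  have ae: "a e v = v" for v using aeq[OF e] by (simp add: Re Pe)
  have Rinv: "norm u \<le> 2 * norm (R x u)" if x: "x \<in> ball e r" for x u
  proof -
    have "norm (R x u - R e u) \<le> K * norm (x - e) * norm u" using Rlip[OF x e] .
    also have "\<dots> \<le> 1 / 2 * norm u"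
    proof (intro mult_right_mono)
      have "K * norm (x - e) \<le> K * r" using x r1 by (intro mult_left_mono) (auto simp: dist_norm norm_minus_commute)
      then show "K * norm (x - e) \<le> 1 / 2" using rK by simp
    qed simp
    finally have "norm (R x u - u) \<le> 1 / 2 * norm u" by (simp add: Re)
    moreover have "norm u \<le> norm (R x u) + norm (R x u - u)"
      using norm_triangle_sub[of u "R x u"] by (simp add: norm_minus_commute)
    ultimately show ?thesis by simp
  qed
  have abound: "norm (a x v) \<le> 3 * norm v" if x: "x \<in> ball e r" for x v
  proof -
    have "norm (P x v - P e v) \<le> K * norm (x - e) * norm v" using Plip[OF x e] .
    also have "\<dots> \<le> 1 / 2 * norm v"
    proof (intro mult_right_mono)
      have "K * norm (x - e) \<le> K * r" using x r1 by (intro mult_left_mono) (auto simp: dist_norm norm_minus_commute)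
      then show "K * norm (x - e) \<le> 1 / 2" using rK by simp
    qed simp
    finally have "norm (P x v - v) \<le> 1 / 2 * norm v" by (simp add: Pe)
    then have "norm (P x v) \<le> 3 / 2 * norm v" using norm_triangle_sub[of "P x v" v] by simp
    then show ?thesis using Rinv[OF x, of "a x v"] aeq[OF x, of v] by simp
  qed
  have alip: "norm (a x v - a y v) \<le> 8 * K * norm (x - y) * norm v" if x: "x \<in> ball e r" and y: "y \<in> ball e r" for x y v
  proof -
    have "R x (a x v - a y v) = (P x v - P y v) - (R x (a y v) - R y (a y v))"
      using aeq[OF x, of v] aeq[OF y, of v] linear_diff[OF linR[OF x]] by simp
    also have "norm \<dots> \<le> K * norm (x - y) * norm v + K * norm (x - y) * (3 * norm v)"
    proof (rule norm_triangle_le_diff[OF add_mono])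
      show "norm (P x v - P y v) \<le> K * norm (x - y) * norm v" using Plip[OF x y] .
      have "norm (R x (a y v) - R y (a y v)) \<le> K * norm (x - y) * norm (a y v)" using Rlip[OF x y] .
      also have "\<dots> \<le> K * norm (x - y) * (3 * norm v)" using r1 abound[OF y] by (intro mult_left_mono) auto
      finally show "norm (R x (a y v) - R y (a y v)) \<le> K * norm (x - y) * (3 * norm v)" .
    qed
    finally show ?thesis using Rinv[OF x, of "a x v - a y v"] by (simp add: algebra_simps)
  qed
  have dd: "(\<lambda>z. ?D z w) differentiable (at (e, e))" for w using C2' S by (simp del: split_paired_All)
  define H where "H w = frechet_derivative (\<lambda>z. ?D z w) (at (e, e))" for w
  have H: "((\<lambda>z. ?D z w) has_derivative H w) (at (e, e))" for w
    using dd unfolding H_def by (simp add: frechet_derivative_works)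
  define B where "B h v = H (0, v) (h, 0) - H (v, 0) (0, h)" for h v
  have der: "((\<lambda>x. a x v) has_derivative (\<lambda>h. B h v)) (at e)" for v
  proof -
    have dP: "((\<lambda>x. P x v) has_derivative (\<lambda>h. H (0, v) (h, 0))) (at e)"
      unfolding P_def
      by (rule has_derivative_compose[of "\<lambda>x. (x, e)" "\<lambda>u. (u, 0)" e UNIV "\<lambda>z. ?D z (0, v)", OF _ H])
         (auto intro!: derivative_eq_intros)
    have dR: "((\<lambda>x. R x v) has_derivative (\<lambda>h. H (v, 0) (0, h))) (at e)"
      unfolding R_def
      by (rule has_derivative_compose[of "\<lambda>x. (e, x)" "\<lambda>u. (0, u)" e UNIV "\<lambda>z. ?D z (v, 0)", OF _ H])
         (auto intro!: derivative_eq_intros)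
    \<comment> \<open>The second-order remainder: \<open>R x\<close> is close to the identity and \<open>a x v\<close> is close to \<open>v\<close>.\<close>
    define E where "E x = (a x v - v) - R x (a x v - v)" for x
    have "norm (E x) \<le> (8 * K * K * norm v) * (norm (x - e))\<^sup>2" if x: "x \<in> ball e r" for x
    proof -
      have "norm (E x) = norm (R x (a x v - v) - R e (a x v - v))" by (simp add: E_def Re norm_minus_commute)
      also have "\<dots> \<le> K * norm (x - e) * norm (a x v - v)" using Rlip[OF x e] .
      also have "\<dots> \<le> K * norm (x - e) * (8 * K * norm (x - e) * norm v)"
        using alip[OF x e, of v] r1 by (intro mult_left_mono) (auto simp: ae)
      finally show ?thesis by (simp add: power2_eq_square mult_ac)
    qed
    then have dE: "(E has_derivative (\<lambda>h. 0)) (at e)"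
      using has_derivative_zero_quadratic r(1) by blast
    have "((\<lambda>x. v + (P x v - R x v) + E x) has_derivative (\<lambda>h. 0 + (H (0, v) (h, 0) - H (v, 0) (0, h)) + 0)) (at e)"
      by (intro has_derivative_add has_derivative_diff has_derivative_const dP dR dE)
    then have "((\<lambda>x. v + (P x v - R x v) + E x) has_derivative (\<lambda>h. B h v)) (at e)"
      by (simp add: B_def)
    moreover have "v + (P x v - R x v) + E x = a x v" if x: "x \<in> ball e r" for x
      using aeq[OF x, of v] linear_diff[OF linR[OF x]] by (simp add: E_def)
    ultimately show ?thesis
      using has_derivative_transform_within_open[of "\<lambda>x. v + (P x v - R x v) + E x" _ e UNIV "ball e r"] e
      by auto
  qed
  have "B w w = 0" for w
    using symmetric_second_derivative[OF S diff(1) H[of "(0, w)"] H[of "(w, 0)"]] by (simp add: B_def)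
  moreover have "bilinear B"
    unfolding bilinear_def
  proof (intro conjI allI)
    show "linear (\<lambda>h. B h v)" for v using der has_derivative_linear by blast
    show "linear (\<lambda>v. B h v)" for h
    proof (rule linearI)
      show "B h (v + w) = B h v + B h w" for v w
      proof -
        have "((\<lambda>x. a x v + a x w) has_derivative (\<lambda>h. B h v + B h w)) (at e)"
          by (intro has_derivative_add der)
        then have "((\<lambda>x. a x (v + w)) has_derivative (\<lambda>h. B h v + B h w)) (at e)"
          by (rule has_derivative_transform_within_open[of _ _ _ _ "ball e r"])
             (use e alin in \<open>auto simp: linear_add\<close>)
        from has_derivative_unique[OF der this] show ?thesis by meson
      qed
      show "B h (c *\<^sub>R v) = c *\<^sub>R B h v" for c v
      proof -
        have "((\<lambda>x. c *\<^sub>R a x v) has_derivative (\<lambda>h. c *\<^sub>R B h v)) (at e)"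
          by (intro has_derivative_scaleR_right der)
        then have "((\<lambda>x. a x (c *\<^sub>R v)) has_derivative (\<lambda>h. c *\<^sub>R B h v)) (at e)"
          by (rule has_derivative_transform_within_open[of _ _ _ _ "ball e r"])
             (use e alin in \<open>auto simp: linear_cmul\<close>)
        from has_derivative_unique[OF der this] show ?thesis by meson
      qed
    qed
  qed
  ultimately show ?thesis using that der r(1) alip by blast
qed

section \<open>Translations and the adjoint representation in charts\<close>

definition in_charts :: "('a \<Rightarrow> 'b) \<Rightarrow> ('a, 'e) chart \<Rightarrow> ('b, 'f) chart \<Rightarrow> 'e \<Rightarrow> 'f" where
  "in_charts f c d = snd d \<circ> f \<circ> chart_inv c"

lemma prod_atlasI: "(U, \<phi>) \<in> A \<Longrightarrow> (V, \<psi>) \<in> B \<Longrightarrow> (U \<times> V, map_prod \<phi> \<psi>) \<in> prod_atlas A B"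
  unfolding prod_atlas_def by blast

lemma smooth_mapD:
  "smooth_map T A T' B f \<Longrightarrow> (U, \<phi>) \<in> A \<Longrightarrow> (V, \<psi>) \<in> B \<Longrightarrow>
    smooth_on (\<psi> \<circ> f \<circ> chart_inv (U, \<phi>)) (\<phi> ` (U \<inter> f -` V))"
  unfolding smooth_map_def by blast

context smooth_manifold
begin

lemma chart_inv_chart:
  assumes "c \<in> A" "p \<in> fst c"
  shows "chart_inv c (snd c p) = p"
proof -
  obtain U \<phi> where c: "c = (U, \<phi>)" by (cases c)
  have "homeomorphic_map (subtopology T U) (top_of_set (\<phi> ` U)) \<phi>"
    using chart_homeomorphic assms c by blast
  then have "inj_on \<phi> (topspace (subtopology T U))" by (rule homeomorphic_imp_injective_map)
  moreover have "topspace (subtopology T U) = U"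
    using chart_open[of U \<phi>] assms c openin_subset by auto
  ultimately show ?thesis using assms c by (simp add: chart_inv_def)
qed

lemma chart_subset: "c \<in> A \<Longrightarrow> fst c \<subseteq> topspace T"
  using covering by auto

lemma chart_domain_open: "c \<in> A \<Longrightarrow> openin T (fst c)"
  using chart_open[of "fst c" "snd c"] by simp

lemma chart_at: "p \<in> topspace T \<Longrightarrow> chart_at A p \<in> A" "p \<in> topspace T \<Longrightarrow> p \<in> fst (chart_at A p)"
  unfolding chart_at_def covering UN_iff Bex_def by (metis (mono_tags, lifting) someI_ex)+

lemma open_chart_image:
  assumes c: "c \<in> A" and Q: "openin T Q"
  shows "open (snd c ` (fst c \<inter> Q))"
proof -
  obtain U \<phi> where c': "c = (U, \<phi>)" by (cases c)
  have "homeomorphic_map (subtopology T U) (top_of_set (\<phi> ` U)) \<phi>"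
    using chart_homeomorphic c c' by blast
  then have om: "open_map (subtopology T U) (top_of_set (\<phi> ` U)) \<phi>" by (rule homeomorphic_imp_open_map)
  have "openin (subtopology T U) (U \<inter> Q)" using Q by (metis openin_subtopology_Int2)
  with om have "openin (top_of_set (\<phi> ` U)) (\<phi> ` (U \<inter> Q))" unfolding open_map_def by blast
  moreover have "open (\<phi> ` U)" using chart_open c c' by blast
  ultimately show ?thesis using c' openin_open_eq by auto
qed

lemma openin_chart_preimage:
  assumes c: "c \<in> A" and S: "open S"
  shows "openin T {p \<in> fst c. snd c p \<in> S}"
proof -
  obtain U \<phi> where c': "c = (U, \<phi>)" by (cases c)
  have "homeomorphic_map (subtopology T U) (top_of_set (\<phi> ` U)) \<phi>"
    using chart_homeomorphic c c' by blast
  then have "continuous_map (subtopology T U) euclidean \<phi>"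
    using homeomorphic_imp_continuous_map continuous_map_in_subtopology by blast
  then have "openin (subtopology T U) {p \<in> topspace (subtopology T U). \<phi> p \<in> S}"
    using S openin_continuous_map_preimage open_openin by blast
  moreover have U: "openin T U" using chart_open c c' by blast
  moreover have "{p \<in> topspace (subtopology T U). \<phi> p \<in> S} = {p \<in> fst c. snd c p \<in> S}"
    using openin_subset[OF U] c' by auto
  ultimately show ?thesis by (simp add: openin_open_subtopology)
qed

lemma eventually_chart_inv:
  assumes c: "c \<in> A" and p: "p \<in> fst c" and Q: "openin T Q" "p \<in> Q"
  shows "\<forall>\<^sub>F x in nhds (snd c p). chart_inv c x \<in> fst c \<inter> Q \<and> snd c (chart_inv c x) = x"
proof -
  have "\<forall>\<^sub>F x in nhds (snd c p). x \<in> snd c ` (fst c \<inter> Q)"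
    using eventually_nhds_in_open[OF open_chart_image[OF c Q(1)]] p Q by blast
  then show ?thesis by eventually_elim (auto simp: chart_inv_chart[OF c])
qed

lemma in_charts_at: "c \<in> A \<Longrightarrow> p \<in> fst c \<Longrightarrow> in_charts f c d (snd c p) = snd d (f p)"
  by (simp add: in_charts_def chart_inv_chart)

lemma in_charts_has_derivative_cong:
  assumes D: "(in_charts f c d has_derivative D) (at (snd c p))" and c: "c \<in> A" "p \<in> fst c"
    and eq: "\<And>x. x \<in> topspace T \<Longrightarrow> f x = g x"
  shows "(in_charts g c d has_derivative D) (at (snd c p))"
proof (rule has_derivative_transform_eventually[OF D])
  have "\<forall>\<^sub>F x in nhds (snd c p). in_charts f c d x = in_charts g c d x"
    using eventually_chart_inv[OF c chart_domain_open[OF c(1)] c(2)]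
    by eventually_elim (use eq chart_subset[OF c(1)] in \<open>auto simp: in_charts_def\<close>)
  then show "\<forall>\<^sub>F x in at (snd c p). in_charts f c d x = in_charts g c d x" by (auto simp: eventually_at_filter elim!: eventually_mono)
  show "in_charts f c d (snd c p) = in_charts g c d (snd c p)"
    using c eq chart_subset[OF c(1)] by (auto simp: in_charts_at)
qed simp

text \<open>
  The chain rule for maps of the manifold, read in arbitrary charts. Continuity of \<open>f\<close> ensures that
  points near \<open>p\<close> are mapped into the intermediate chart.
\<close>

lemma in_charts_comp_has_derivative:
  assumes c: "c \<in> A" "p \<in> fst c" and d: "d \<in> A" "f p \<in> fst d"
    and f: "continuous_map T T f"
    and F: "(in_charts f c d has_derivative F) (at (snd c p))"
    and H: "(in_charts h d e has_derivative H) (at (snd d (f p)))"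
  shows "(in_charts (h \<circ> f) c e has_derivative (\<lambda>v. H (F v))) (at (snd c p))"
proof (rule has_derivative_transform_eventually)
  have "(in_charts h d e has_derivative H) (at (in_charts f c d (snd c p)))"
    using H c by (simp add: in_charts_at)
  from has_derivative_compose[OF F this]
  show "((\<lambda>x. in_charts h d e (in_charts f c d x)) has_derivative (\<lambda>v. H (F v))) (at (snd c p))" .
  have "openin T {x \<in> topspace T. f x \<in> fst d}"
    using openin_continuous_map_preimage[OF f chart_domain_open[OF d(1)]] .
  moreover have "p \<in> {x \<in> topspace T. f x \<in> fst d}" using c d chart_subset[OF c(1)] by auto
  ultimately have "\<forall>\<^sub>F x in nhds (snd c p). chart_inv c x \<in> fst c \<inter> {x \<in> topspace T. f x \<in> fst d} \<and>
      snd c (chart_inv c x) = x"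
    by (rule eventually_chart_inv[OF c])
  then have "\<forall>\<^sub>F x in nhds (snd c p). in_charts h d e (in_charts f c d x) = in_charts (h \<circ> f) c e x"
    by eventually_elim (auto simp: in_charts_def chart_inv_chart[OF d(1)])
  then show "\<forall>\<^sub>F x in at (snd c p). in_charts h d e (in_charts f c d x) = in_charts (h \<circ> f) c e x"
    by (auto simp: eventually_at_filter elim!: eventually_mono)
  show "in_charts h d e (in_charts f c d (snd c p)) = in_charts (h \<circ> f) c e (snd c p)"
    using c d by (simp add: in_charts_at)
qed simp

end

context lie_group
begin

lemma mult_continuous: "continuous_map (prod_topology T T) T (\<lambda>(x, y). x \<otimes> y)"
  using smooth_mult by (simp add: smooth_map_def)

lemma left_translation_continuous: "g \<in> carrier G \<Longrightarrow> continuous_map T T (\<lambda>x. g \<otimes> x)"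
  using continuous_map_compose[OF _ mult_continuous, of T "\<lambda>x. (g, x)"] carrier
  by (auto simp: o_def continuous_map_pairwise)

lemma right_translation_continuous: "g \<in> carrier G \<Longrightarrow> continuous_map T T (\<lambda>x. x \<otimes> g)"
  using continuous_map_compose[OF _ mult_continuous, of T "\<lambda>x. (x, g)"] carrier
  by (auto simp: o_def continuous_map_pairwise)

text \<open>
  The coordinate expression of the multiplication. Fixing one argument gives the coordinate expression
  of a translation.
\<close>

definition mult_chart :: "('a, 'e) chart \<Rightarrow> ('a, 'e) chart \<Rightarrow> ('a, 'e) chart \<Rightarrow> 'e \<times> 'e \<Rightarrow> 'e" where
  "mult_chart c d e = (\<lambda>(x, y). snd e (chart_inv c x \<otimes> chart_inv d y))"

text \<open>
  The domain on which smoothness of the multiplication is given is only known as an image of a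
  preimage. It is shrunk to an open product neighbourhood, where the inverse of the product chart is
  the pair of the inverses of the factors.
\<close>

lemma mult_chart_C2:
  assumes c: "c \<in> A" "p \<in> fst c" and d: "d \<in> A" "q \<in> fst d" and e: "e \<in> A" "p \<otimes> q \<in> fst e"
  obtains S where "open S" "(snd c p, snd d q) \<in> S" "Ck_on 2 (mult_chart c d e) S"
proof -
  let ?mult = "\<lambda>(x, y). x \<otimes> y"
  define Z where "Z = {z \<in> topspace (prod_topology T T). ?mult z \<in> fst e}"
  have Z: "openin (prod_topology T T) Z"
    unfolding Z_def by (rule openin_continuous_map_preimage[OF mult_continuous chart_domain_open[OF e(1)]])
  have pq: "(p, q) \<in> Z"
    unfolding Z_def using c(2) d(2) e(2) chart_subset[OF c(1)] chart_subset[OF d(1)] by auto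
  obtain P Q where PQ: "openin T P" "openin T Q" "p \<in> P" "q \<in> Q" "P \<times> Q \<subseteq> Z"
    using Z[unfolded openin_prod_topology_alt, rule_format, OF pq] by (elim exE conjE) (rule that)
  define S where "S = snd c ` (fst c \<inter> P) \<times> snd d ` (fst d \<inter> Q)"
  have "open S" unfolding S_def using open_chart_image c d PQ by (intro open_Times) auto
  let ?cd = "(fst c \<times> fst d, map_prod (snd c) (snd d))"
  have "(fst c, snd c) \<in> A" "(fst d, snd d) \<in> A" using c d by simp_all
  then have "?cd \<in> prod_atlas A A" by (rule prod_atlasI)
  moreover have "(fst e, snd e) \<in> A" using e by simp
  ultimately have "smooth_on (snd e \<circ> ?mult \<circ> chart_inv ?cd)
      (map_prod (snd c) (snd d) ` (fst c \<times> fst d \<inter> ?mult -` fst e))"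
    using smooth_mapD[OF smooth_mult] by blast
  then have "Ck_on 2 (snd e \<circ> ?mult \<circ> chart_inv ?cd)
      (map_prod (snd c) (snd d) ` (fst c \<times> fst d \<inter> ?mult -` fst e))" by (simp add: smooth_on_def)
  moreover have "S \<subseteq> map_prod (snd c) (snd d) ` (fst c \<times> fst d \<inter> ?mult -` fst e)"
    using PQ(5) unfolding S_def Z_def by (fastforce simp: map_prod_def image_iff)
  ultimately have "Ck_on 2 (snd e \<circ> ?mult \<circ> chart_inv ?cd) S" by (rule Ck_on_subset)
  moreover have "(snd e \<circ> ?mult \<circ> chart_inv ?cd) z = mult_chart c d e z" if zS: "z \<in> S" for z
  proof -
    obtain x y where z: "z = (snd c x, snd d y)" "x \<in> fst c" "y \<in> fst d"
      using zS unfolding S_def by auto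
    have "inj_on (map_prod (snd c) (snd d)) (fst c \<times> fst d)"
      by (intro map_prod_inj_on inj_on_inverseI[where g = "chart_inv c"] inj_on_inverseI[where g = "chart_inv d"])
         (simp_all add: chart_inv_chart c d)
    then have "chart_inv ?cd (map_prod (snd c) (snd d) (x, y)) = (x, y)"
      using inv_into_f_f[of "map_prod (snd c) (snd d)" "fst c \<times> fst d" "(x, y)"] z
      by (simp add: chart_inv_def)
    then show ?thesis using z c d by (simp add: mult_chart_def chart_inv_chart)
  qed
  ultimately have "Ck_on 2 (mult_chart c d e) S" using Ck_on_cong \<open>open S\<close> by blast
  moreover have "(snd c p, snd d q) \<in> S" using c d PQ by (auto simp: S_def)
  ultimately show ?thesis using that \<open>open S\<close> by blast
qed

lemma mult_chart_has_derivative: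
  assumes "c \<in> A" "p \<in> fst c" "d \<in> A" "q \<in> fst d" "e \<in> A" "p \<otimes> q \<in> fst e"
  shows "(mult_chart c d e has_derivative frechet_derivative (mult_chart c d e) (at (snd c p, snd d q)))
    (at (snd c p, snd d q))"
proof -
  obtain S where "open S" "(snd c p, snd d q) \<in> S" "Ck_on 2 (mult_chart c d e) S"
    using mult_chart_C2[OF assms] .
  then show ?thesis by (simp add: numeral_2_eq_2 frechet_derivative_works)
qed

lemma left_translation_has_derivative:
  assumes c: "c \<in> A" "g \<in> fst c" and d: "d \<in> A" "q \<in> fst d" and e: "e \<in> A" "g \<otimes> q \<in> fst e"
  shows "(in_charts (\<lambda>x. g \<otimes> x) d e has_derivative
    (\<lambda>v. frechet_derivative (mult_chart c d e) (at (snd c g, snd d q)) (0, v))) (at (snd d q))"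
proof -
  have "((\<lambda>y. mult_chart c d e (snd c g, y)) has_derivative
    (\<lambda>v. frechet_derivative (mult_chart c d e) (at (snd c g, snd d q)) (0, v))) (at (snd d q))"
    by (rule has_derivative_compose[of "\<lambda>y. (snd c g, y)" "\<lambda>v. (0, v)", OF _ mult_chart_has_derivative[OF assms]])
       (auto intro!: derivative_eq_intros)
  moreover have "(\<lambda>y. mult_chart c d e (snd c g, y)) = in_charts (\<lambda>x. g \<otimes> x) d e"
    using c by (auto simp: mult_chart_def in_charts_def chart_inv_chart)
  ultimately show ?thesis by simp
qed

lemma right_translation_has_derivative:
  assumes c: "c \<in> A" "p \<in> fst c" and d: "d \<in> A" "g \<in> fst d" and e: "e \<in> A" "p \<otimes> g \<in> fst e"
  shows "(in_charts (\<lambda>x. x \<otimes> g) c e has_derivative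
    (\<lambda>v. frechet_derivative (mult_chart c d e) (at (snd c p, snd d g)) (v, 0))) (at (snd c p))"
proof -
  have "((\<lambda>y. mult_chart c d e (y, snd d g)) has_derivative
    (\<lambda>v. frechet_derivative (mult_chart c d e) (at (snd c p, snd d g)) (v, 0))) (at (snd c p))"
    by (rule has_derivative_compose[of "\<lambda>y. (y, snd d g)" "\<lambda>v. (v, 0)", OF _ mult_chart_has_derivative[OF assms]])
       (auto intro!: derivative_eq_intros)
  moreover have "(\<lambda>y. mult_chart c d e (y, snd d g)) = in_charts (\<lambda>x. x \<otimes> g) c e"
    using d by (auto simp: mult_chart_def in_charts_def chart_inv_chart)
  ultimately show ?thesis by simp
qed

lemma left_translation_lipschitz:
  assumes g: "g \<in> carrier G" and d: "d \<in> A" "q \<in> fst d" and e: "e \<in> A" "g \<otimes> q \<in> fst e"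
  obtains r K where "r > 0" "K \<ge> 0"
    "\<And>x y. x \<in> ball (snd d q) r \<Longrightarrow> y \<in> ball (snd d q) r \<Longrightarrow>
      norm (in_charts (\<lambda>x. g \<otimes> x) d e x - in_charts (\<lambda>x. g \<otimes> x) d e y) \<le> K * norm (x - y)"
proof -
  let ?c = "chart_at A g"
  have c: "?c \<in> A" "g \<in> fst ?c" using chart_at g carrier by auto
  obtain S where S: "open S" "(snd ?c g, snd d q) \<in> S" "Ck_on 2 (mult_chart ?c d e) S"
    using mult_chart_C2[OF c d e] .
  have "Ck_on (Suc (Suc 0)) (mult_chart ?c d e) S" using S by (simp add: numeral_2_eq_2)
  then obtain r K where rK: "r > 0" "K \<ge> 0" and lip: "\<And>x y. x \<in> ball (snd ?c g, snd d q) r \<Longrightarrow>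
      y \<in> ball (snd ?c g, snd d q) r \<Longrightarrow> norm (mult_chart ?c d e x - mult_chart ?c d e y) \<le> K * norm (x - y)"
    using Ck_on_Suc_lipschitz[OF _ S(1,2)] by metis
  have *: "in_charts (\<lambda>x. g \<otimes> x) d e y = mult_chart ?c d e (snd ?c g, y)" for y
    using c by (auto simp: mult_chart_def in_charts_def chart_inv_chart)
  show ?thesis
  proof (rule that[OF rK])
    fix x y assume "x \<in> ball (snd d q) r" "y \<in> ball (snd d q) r"
    then show "norm (in_charts (\<lambda>x. g \<otimes> x) d e x - in_charts (\<lambda>x. g \<otimes> x) d e y) \<le> K * norm (x - y)"
      using lip[of "(snd ?c g, x)" "(snd ?c g, y)"] by (simp add: * dist_Pair_Pair norm_Pair)
  qed
qed

abbreviation id_chart :: "('a, 'e) chart" where "id_chart \<equiv> chart_at A \<one>"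
abbreviation id_coord :: "'e" where "id_coord \<equiv> snd id_chart \<one>"

lemma id_chart: "id_chart \<in> A" "\<one> \<in> fst id_chart"
  using chart_at carrier by auto

lemma Ad_has_derivative:
  assumes g: "g \<in> carrier G"
  shows "(in_charts (\<lambda>x. g \<otimes> x \<otimes> inv g) id_chart id_chart has_derivative Ad G A g) (at id_coord)"
proof -
  let ?c = "chart_at A g" and ?i = "chart_at A (inv g)"
  have c: "?c \<in> A" "g \<in> fst ?c" and i: "?i \<in> A" "inv g \<in> fst ?i"
    using chart_at g carrier by auto
  have "\<exists>D. (in_charts ((\<lambda>x. x \<otimes> inv g) \<circ> (\<lambda>x. g \<otimes> x)) id_chart id_chart has_derivative D) (at id_coord)"
    by (rule exI, rule in_charts_comp_has_derivative[OF id_chart c(1) _ left_translation_continuous[OF g]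
      left_translation_has_derivative[OF c id_chart c(1)] right_translation_has_derivative[OF c(1) _ i id_chart(1)]])
      (use g c id_chart in auto)
  then have "in_charts (\<lambda>x. g \<otimes> x \<otimes> inv g) id_chart id_chart differentiable (at id_coord)"
    by (auto simp: differentiable_def o_def)
  moreover have "Ad G A g = frechet_derivative (in_charts (\<lambda>x. g \<otimes> x \<otimes> inv g) id_chart id_chart) (at id_coord)"
    using g by (simp add: Ad_def tangent_map_def in_charts_def)
  ultimately show ?thesis by (simp add: frechet_derivative_works)
qed

lemma Ad_linear: "g \<in> carrier G \<Longrightarrow> linear (Ad G A g)"
  using Ad_has_derivative has_derivative_linear by blast

lemma conj_continuous: "g \<in> carrier G \<Longrightarrow> continuous_map T T (\<lambda>x. g \<otimes> x \<otimes> inv g)"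
  using continuous_map_compose[OF left_translation_continuous right_translation_continuous, of g "inv g"]
  by (simp add: o_def)

text \<open>
  Conjugation by a product is the composition of the conjugations, so this is the chain rule.
\<close>

lemma Ad_mult:
  assumes g: "g \<in> carrier G" and h: "h \<in> carrier G"
  shows "Ad G A (g \<otimes> h) v = Ad G A g (Ad G A h v)"
proof -
  have "(in_charts ((\<lambda>x. g \<otimes> x \<otimes> inv g) \<circ> (\<lambda>x. h \<otimes> x \<otimes> inv h)) id_chart id_chart
      has_derivative (\<lambda>v. Ad G A g (Ad G A h v))) (at id_coord)"
    by (rule in_charts_comp_has_derivative[OF id_chart id_chart(1) _ conj_continuous[OF h] Ad_has_derivative[OF h]])
       (use Ad_has_derivative[OF g] h id_chart in auto)
  then have "(in_charts (\<lambda>x. (g \<otimes> h) \<otimes> x \<otimes> inv (g \<otimes> h)) id_chart id_chart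
      has_derivative (\<lambda>v. Ad G A g (Ad G A h v))) (at id_coord)"
    by (rule in_charts_has_derivative_cong[OF _ id_chart]) (use g h carrier in \<open>auto simp: m_assoc inv_mult_group\<close>)
  from has_derivative_unique[OF Ad_has_derivative this] g h show ?thesis by (metis m_closed)
qed

text \<open>
  Conjugation by \<open>g\<close> followed by right translation by \<open>g\<close> is left translation by \<open>g\<close>; differentiate at the identity.
\<close>

lemma Ad_translation_derivatives:
  assumes g: "g \<in> fst id_chart"
  shows "frechet_derivative (mult_chart id_chart id_chart id_chart) (at (id_coord, snd id_chart g)) (Ad G A g v, 0)
    = frechet_derivative (mult_chart id_chart id_chart id_chart) (at (snd id_chart g, id_coord)) (0, v)"
proof -
  note c = id_chart
  have gG: "g \<in> carrier G" using g chart_subset[OF c(1)] carrier by auto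
  let ?D = "\<lambda>z. frechet_derivative (mult_chart id_chart id_chart id_chart) (at z)"
  have R: "(in_charts (\<lambda>x. x \<otimes> g) id_chart id_chart has_derivative (\<lambda>v. ?D (id_coord, snd id_chart g) (v, 0))) (at id_coord)"
    by (rule right_translation_has_derivative[OF c c(1) g c(1)]) (use g gG in simp)
  have L: "(in_charts (\<lambda>x. g \<otimes> x) id_chart id_chart has_derivative (\<lambda>v. ?D (snd id_chart g, id_coord) (0, v))) (at id_coord)"
    by (rule left_translation_has_derivative[OF c(1) g c c(1)]) (use g gG in simp)
  have "(in_charts ((\<lambda>x. x \<otimes> g) \<circ> (\<lambda>x. g \<otimes> x \<otimes> inv g)) id_chart id_chart has_derivative
      (\<lambda>v. ?D (id_coord, snd id_chart g) (Ad G A g v, 0))) (at id_coord)"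
    by (rule in_charts_comp_has_derivative[OF c c(1) _ conj_continuous[OF gG] Ad_has_derivative[OF gG]])
       (use R gG c in auto)
  then have "(in_charts (\<lambda>x. g \<otimes> x) id_chart id_chart has_derivative
      (\<lambda>v. ?D (id_coord, snd id_chart g) (Ad G A g v, 0))) (at id_coord)"
    by (rule in_charts_has_derivative_cong[OF _ c]) (use gG carrier in \<open>auto simp: m_assoc\<close>)
  from has_derivative_unique[OF this L] show ?thesis by meson
qed

lemma Ad_derivative_at_one:
  obtains B r K where "bilinear B" "\<And>w. B w w = 0"
    "\<And>v. ((\<lambda>x. Ad G A (chart_inv id_chart x) v) has_derivative (\<lambda>h. B h v)) (at id_coord)"
    "r > 0" "\<And>x y v. x \<in> ball id_coord r \<Longrightarrow> y \<in> ball id_coord r \<Longrightarrow>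
      norm (Ad G A (chart_inv id_chart x) v - Ad G A (chart_inv id_chart y) v) \<le> K * norm (x - y) * norm v"
proof -
  let ?m = "mult_chart id_chart id_chart id_chart"
  obtain S where S: "open S" "(id_coord, id_coord) \<in> S" "Ck_on 2 ?m S"
    using mult_chart_C2[OF id_chart id_chart id_chart(1)] id_chart by auto
  have near: "\<forall>\<^sub>F x in nhds id_coord. chart_inv id_chart x \<in> fst id_chart \<and> snd id_chart (chart_inv id_chart x) = x"
    using eventually_chart_inv[OF id_chart chart_domain_open[OF id_chart(1)] id_chart(2)] by simp
  have sub: "fst id_chart \<subseteq> carrier G" using chart_subset[OF id_chart(1)] carrier by simp
  show ?thesis
  proof (rule local_adjoint_derivative[OF S, of "\<lambda>x. Ad G A (chart_inv id_chart x)"])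
    show "\<forall>\<^sub>F x in nhds id_coord. ?m (x, id_coord) = x"
      using near by eventually_elim (use sub id_chart in \<open>auto simp: mult_chart_def chart_inv_chart\<close>)
    show "\<forall>\<^sub>F x in nhds id_coord. ?m (id_coord, x) = x"
      using near by eventually_elim (use sub id_chart in \<open>auto simp: mult_chart_def chart_inv_chart\<close>)
    show "\<forall>\<^sub>F x in nhds id_coord. linear (Ad G A (chart_inv id_chart x))"
      using near by eventually_elim (use sub Ad_linear in auto)
    show "\<forall>\<^sub>F x in nhds id_coord. \<forall>v. frechet_derivative ?m (at (id_coord, x)) (Ad G A (chart_inv id_chart x) v, 0)
       = frechet_derivative ?m (at (x, id_coord)) (0, v)"
      using near by eventually_elim (use Ad_translation_derivatives in metis)
  qed (rule that, assumption+)
qed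

lemma curve_stays_in_open:
  fixes I :: "real set"
  assumes \<gamma>: "continuous_map (top_of_set I) T \<gamma>" and t: "t \<in> I" and Q: "openin T Q" "\<gamma> t \<in> Q"
  obtains d where "d > 0" "\<And>s. s \<in> I \<Longrightarrow> \<bar>s - t\<bar> < d \<Longrightarrow> \<gamma> s \<in> Q"
proof -
  have "openin (top_of_set I) {s \<in> I. \<gamma> s \<in> Q}"
    using openin_continuous_map_preimage[OF \<gamma> Q(1)] by simp
  then obtain d where "d > 0" "\<forall>s\<in>I. dist s t < d \<longrightarrow> s \<in> {s \<in> I. \<gamma> s \<in> Q}"
    using t Q unfolding openin_euclidean_subtopology_iff by blast
  then show ?thesis using that by (auto simp: dist_real_def)
qed

text \<open>
  Reduces the adjoint map near an arbitrary \<open>g\<close> to a neighbourhood of the identity, the only place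
  where its regularity is known from the multiplication alone.
\<close>

lemma Ad_curve_factor:
  assumes g: "g \<in> carrier G" and p: "p \<in> fst (chart_at A g)" "inv g \<otimes> p \<in> fst id_chart"
  shows "Ad G A p v = Ad G A g (Ad G A (chart_inv id_chart
    (in_charts (\<lambda>x. inv g \<otimes> x) (chart_at A g) id_chart (snd (chart_at A g) p))) v)"
proof -
  have c: "chart_at A g \<in> A" using chart_at g carrier by auto
  have pG: "p \<in> carrier G" using p chart_subset[OF c] carrier by auto
  have "chart_inv id_chart (in_charts (\<lambda>x. inv g \<otimes> x) (chart_at A g) id_chart (snd (chart_at A g) p)) = inv g \<otimes> p"
    using p by (simp add: in_charts_at[OF c] chart_inv_chart[OF id_chart(1)])
  moreover have "p = g \<otimes> (inv g \<otimes> p)" using g pG by (simp add: m_assoc[symmetric])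
  ultimately show ?thesis using Ad_mult[of g "inv g \<otimes> p"] g pG by (metis inv_closed m_closed)
qed

lemma inv_translate_near_one:
  assumes g: "g \<in> carrier G"
  shows "openin T {p \<in> topspace T. inv g \<otimes> p \<in> fst id_chart}" "g \<in> {p \<in> topspace T. inv g \<otimes> p \<in> fst id_chart}"
  using openin_continuous_map_preimage[OF left_translation_continuous chart_domain_open[OF id_chart(1)], of "inv g"]
    g carrier id_chart by auto

text \<open>
  Near \<open>t\<close>, the function is a Lipschitz function of the chart coordinates of \<open>\<gamma>\<close>: left translation by
  the inverse of \<open>\<gamma> t\<close>, then the adjoint map near the identity, then a linear functional.
\<close>

lemma Ad_curve_abs_continuous:
  assumes \<gamma>: "abs_continuous_curve T A I \<gamma>" and l: "linear l" and t: "t \<in> I"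
  shows "\<exists>d>0. \<forall>a b. a \<le> t \<and> t \<le> b \<and> b - a < d \<and> {a..b} \<subseteq> I \<longrightarrow>
    abs_continuous_on {a..b} (\<lambda>s. (l::'e \<Rightarrow> real) (Ad G A (\<gamma> s) v))"
proof -
  define g where "g = \<gamma> t"
  define c where "c = chart_at A g"
  have cont: "continuous_map (top_of_set I) T \<gamma>" using \<gamma> by (simp add: abs_continuous_curve_def)
  have g: "g \<in> carrier G" using cont t carrier unfolding g_def continuous_map_def by auto
  have c: "c \<in> A" "g \<in> fst c" unfolding c_def using chart_at g carrier by auto
  let ?L = "in_charts (\<lambda>x. inv g \<otimes> x) c id_chart"
  obtain r1 K1 where r1: "r1 > 0" "K1 \<ge> 0"
    "\<And>x y. x \<in> ball (snd c g) r1 \<Longrightarrow> y \<in> ball (snd c g) r1 \<Longrightarrow> norm (?L x - ?L y) \<le> K1 * norm (x - y)"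
    using left_translation_lipschitz[of "inv g" c g id_chart] g c id_chart by auto
  obtain B r2 K2 where r2: "r2 > 0" "\<And>x y v. x \<in> ball id_coord r2 \<Longrightarrow> y \<in> ball id_coord r2 \<Longrightarrow>
      norm (Ad G A (chart_inv id_chart x) v - Ad G A (chart_inv id_chart y) v) \<le> K2 * norm (x - y) * norm v"
    by (rule Ad_derivative_at_one, rule that, assumption+)
  \<comment> \<open>On this ball the translation maps into the domain of the Lipschitz bound for the adjoint map.\<close>
  define r where "r = min r1 (r2 / (K1 + 1))"
  have r: "r > 0" "r \<le> r1" "r \<le> r2 / (K1 + 1)" using r1 r2 by (auto simp: r_def)
  then have rr: "(K1 + 1) * r \<le> r2" using r1 by (simp add: pos_le_divide_eq mult.commute)
  have Lg: "?L (snd c g) = id_coord" by (subst in_charts_at[OF c]) (use g in simp)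
  have LB: "?L x \<in> ball id_coord r2" if x: "x \<in> ball (snd c g) r" for x
  proof -
    have "norm (?L x - id_coord) \<le> K1 * norm (x - snd c g)"
      using r1(3)[of x "snd c g"] x r r1(1) Lg by auto
    also have "\<dots> \<le> K1 * r" using x r1 by (intro mult_left_mono) (auto simp: dist_norm norm_minus_commute)
    also have "\<dots> < r2" using r rr by (simp add: algebra_simps)
    finally show ?thesis by (simp add: dist_norm norm_minus_commute)
  qed
  define Q where "Q = {p \<in> fst c. snd c p \<in> ball (snd c g) r} \<inter> {p \<in> topspace T. inv g \<otimes> p \<in> fst id_chart}"
  have Q: "openin T Q" "\<gamma> t \<in> Q"
    using openin_chart_preimage[OF c(1), of "ball (snd c g) r"] inv_translate_near_one[OF g] c r
    unfolding Q_def by (auto simp: g_def)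
  obtain d where d: "d > 0" "\<And>s. s \<in> I \<Longrightarrow> \<bar>s - t\<bar> < d \<Longrightarrow> \<gamma> s \<in> Q"
    using curve_stays_in_open[OF cont t Q] by blast
  have "linear (\<lambda>w. l (Ad G A g w))" using linear_compose[OF Ad_linear[OF g] l] by (simp add: o_def)
  then obtain M where M: "M > 0" "\<And>w. norm (l (Ad G A g w)) \<le> M * norm w"
    using linear_bounded_pos by blast
  have la: "linear l" "linear (Ad G A g)" using l Ad_linear[OF g] by auto
  show ?thesis
  proof (intro exI[of _ d] conjI d(1) allI impI)
    fix a b assume ab: "a \<le> t \<and> t \<le> b \<and> b - a < d \<and> {a..b} \<subseteq> I"
    have inQ: "\<gamma> s \<in> Q" if "s \<in> {a..b}" for s using d(2)[of s] ab that by auto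
    then have "\<gamma> ` {a..b} \<subseteq> fst c" by (auto simp: Q_def)
    moreover have "(fst c, snd c) \<in> A" using c by simp
    ultimately have ac: "abs_continuous_on {a..b} (snd c \<circ> \<gamma>)"
      using \<gamma> ab unfolding abs_continuous_curve_def by blast
    show "abs_continuous_on {a..b} (\<lambda>s. l (Ad G A (\<gamma> s) v))"
    proof (rule abs_continuous_on_dominated[where V = "{()}" and f = "\<lambda>_. snd c \<circ> \<gamma>" and K = "M * \<bar>K2\<bar> * K1 * norm v"])
      fix s s' assume s: "s \<in> {a..b}" "s' \<in> {a..b}"
      let ?x = "snd c (\<gamma> s)" and ?y = "snd c (\<gamma> s')"
      have xy: "?x \<in> ball (snd c g) r" "?y \<in> ball (snd c g) r" using inQ s by (auto simp: Q_def)
      have fac: "Ad G A (\<gamma> s) v = Ad G A g (Ad G A (chart_inv id_chart (?L ?x)) v)"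
        "Ad G A (\<gamma> s') v = Ad G A g (Ad G A (chart_inv id_chart (?L ?y)) v)"
        using Ad_curve_factor[OF g] inQ s unfolding c_def Q_def by auto
      have "norm (l (Ad G A (\<gamma> s) v) - l (Ad G A (\<gamma> s') v))
          = norm (l (Ad G A g (Ad G A (chart_inv id_chart (?L ?x)) v - Ad G A (chart_inv id_chart (?L ?y)) v)))"
        unfolding fac by (simp add: linear_diff[OF la(1)] linear_diff[OF la(2)])
      also have "\<dots> \<le> M * norm (Ad G A (chart_inv id_chart (?L ?x)) v - Ad G A (chart_inv id_chart (?L ?y)) v)"
        by (rule M(2))
      also have "\<dots> \<le> M * (\<bar>K2\<bar> * (K1 * norm (?x - ?y)) * norm v)"
      proof (intro mult_left_mono)
        have "norm (Ad G A (chart_inv id_chart (?L ?x)) v - Ad G A (chart_inv id_chart (?L ?y)) v)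
            \<le> K2 * norm (?L ?x - ?L ?y) * norm v" using r2(2) LB xy by blast
        also have "\<dots> \<le> \<bar>K2\<bar> * (K1 * norm (?x - ?y)) * norm v"
          using r1(3)[of ?x ?y] xy r by (intro mult_right_mono mult_mono) auto
        finally show "norm (Ad G A (chart_inv id_chart (?L ?x)) v - Ad G A (chart_inv id_chart (?L ?y)) v)
            \<le> \<bar>K2\<bar> * (K1 * norm (?x - ?y)) * norm v" .
      qed (use M in simp)
      finally show "norm (l (Ad G A (\<gamma> s) v) - l (Ad G A (\<gamma> s') v)) \<le>
          M * \<bar>K2\<bar> * K1 * norm v * (\<Sum>x\<in>{()}. norm ((snd c \<circ> \<gamma>) s - (snd c \<circ> \<gamma>) s'))"
        by (simp add: mult_ac)
    qed (use ac in auto)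
  qed
qed

text \<open>
  The control is by definition the velocity of \<open>s \<mapsto> \<gamma>(t)\<^sup>-\<^sup>1 \<gamma>(s)\<close> at \<open>s = t\<close> in the chart at the
  identity, so the chain rule applies to the factorisation through a neighbourhood of the identity.
\<close>

lemma Ad_curve_derivative:
  assumes cont: "continuous_map (top_of_set I) T \<gamma>" and l: "linear l" and t: "t \<in> I"
    and B: "\<And>v. ((\<lambda>x. Ad G A (chart_inv id_chart x) v) has_derivative (\<lambda>h. B h v)) (at id_coord)"
    and vel: "has_velocity A \<gamma> I t w" and u: "u = tangent_map A A (\<lambda>x. inv (\<gamma> t) \<otimes> x) (\<gamma> t) w"
  shows "((\<lambda>s. (l::'e \<Rightarrow> real) (Ad G A (\<gamma> s) v)) has_vector_derivative l (Ad G A (\<gamma> t) (B u v))) (at t within I)"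
proof -
  define g where "g = \<gamma> t"
  define c where "c = chart_at A g"
  have g: "g \<in> carrier G" using cont t carrier unfolding g_def continuous_map_def by auto
  have c: "c \<in> A" "g \<in> fst c" unfolding c_def using chart_at g carrier by auto
  have i: "chart_at A (inv g) \<in> A" "inv g \<in> fst (chart_at A (inv g))" using chart_at g carrier by auto
  let ?L = "in_charts (\<lambda>x. inv g \<otimes> x) c id_chart"
  have "?L differentiable (at (snd c g))"
    using left_translation_has_derivative[OF i c id_chart(1)] g id_chart by (auto simp: differentiable_def)
  then have "(?L has_derivative frechet_derivative ?L (at (snd c g))) (at (snd c g))"
    by (simp add: frechet_derivative_works)
  moreover have "u = frechet_derivative ?L (at (snd c g)) w"
    using g by (simp add: u tangent_map_def in_charts_def g_def c_def)
  ultimately obtain D where D: "(?L has_derivative D) (at (snd c g))" "D w = u" by blast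
  have Lg: "?L (snd c g) = id_coord" by (subst in_charts_at[OF c]) (use g in simp)
  have linA: "bounded_linear (\<lambda>w. l (Ad G A g w))"
    using linear_compose[OF Ad_linear[OF g] l] by (simp add: o_def linear_linear)
  have 1: "((\<lambda>s. snd c (\<gamma> s)) has_derivative (\<lambda>h. h *\<^sub>R w)) (at t within I)"
    using vel unfolding has_velocity_def has_vector_derivative_def c_def g_def .
  have 2: "((\<lambda>s. ?L (snd c (\<gamma> s))) has_derivative (\<lambda>h. D (h *\<^sub>R w))) (at t within I)"
    using has_derivative_compose[OF 1, of ?L D] D(1) by (simp add: g_def)
  have 3: "((\<lambda>s. Ad G A (chart_inv id_chart (?L (snd c (\<gamma> s)))) v) has_derivative (\<lambda>h. B (D (h *\<^sub>R w)) v)) (at t within I)"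
    using has_derivative_compose[OF 2, of "\<lambda>x. Ad G A (chart_inv id_chart x) v" "\<lambda>h. B h v"] B[of v] Lg
    by (simp add: g_def)
  have 4: "((\<lambda>s. l (Ad G A g (Ad G A (chart_inv id_chart (?L (snd c (\<gamma> s)))) v))) has_derivative
      (\<lambda>h. l (Ad G A g (B (D (h *\<^sub>R w)) v)))) (at t within I)"
    by (rule bounded_linear.has_derivative[OF linA 3])
  have lin: "linear D" "linear (\<lambda>h. B h v)" "linear (\<lambda>w. l (Ad G A g w))"
    using D(1) B[of v] linA has_derivative_linear bounded_linear.linear by blast+
  have eq: "l (Ad G A g (B (D (h *\<^sub>R w)) v)) = h *\<^sub>R l (Ad G A g (B u v))" for h
    using linear_cmul[OF lin(1)] linear_cmul[OF lin(2)] linear_cmul[OF lin(3)] D(2) by simp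
  define Q where "Q = fst c \<inter> {p \<in> topspace T. inv g \<otimes> p \<in> fst id_chart}"
  have Q: "openin T Q" "\<gamma> t \<in> Q"
    using chart_domain_open[OF c(1)] inv_translate_near_one[OF g] c unfolding Q_def by (auto simp: g_def)
  obtain d where d: "d > 0" "\<And>s. s \<in> I \<Longrightarrow> \<bar>s - t\<bar> < d \<Longrightarrow> \<gamma> s \<in> Q"
    using curve_stays_in_open[OF cont t Q] by blast
  have fac: "l (Ad G A g (Ad G A (chart_inv id_chart (?L (snd c (\<gamma> s)))) v)) = l (Ad G A (\<gamma> s) v)"
    if "s \<in> I" "\<bar>s - t\<bar> < d" for s
    using Ad_curve_factor[OF g, of "\<gamma> s" v] d(2)[OF that] by (simp add: Q_def c_def)
  have "((\<lambda>s. l (Ad G A (\<gamma> s) v)) has_derivative (\<lambda>h. h *\<^sub>R l (Ad G A g (B u v)))) (at t within I)"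
  proof (rule has_derivative_transform_within[OF 4[unfolded eq] d(1) t])
    show "l (Ad G A g (Ad G A (chart_inv id_chart (?L (snd c (\<gamma> s)))) v)) = l (Ad G A (\<gamma> s) v)"
      if "s \<in> I" "dist s t < d" for s
      using fac that by (simp add: dist_real_def)
  qed
  then show ?thesis by (simp add: has_vector_derivative_def g_def)
qed

end

section \<open>Linear functionals on polytopes\<close>

lemma linear_functional_inner:
  fixes \<eta> :: "'e::euclidean_space \<Rightarrow> real"
  assumes "linear \<eta>"
  obtains a where "\<And>v. \<eta> v = a \<bullet> v"
  using adjoint_works[OF assms, of _ 1] that[of "adjoint \<eta> 1"] by (simp add: inner_commute)

text \<open>
  In a convex combination whose value attains the bound, every vertex with positive weight attains it.
\<close>

lemma convex_hull_active:
  fixes V :: "'e::euclidean_space set"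
  assumes V: "finite V" and w: "w \<in> convex hull V" and le: "\<And>v. v \<in> V \<Longrightarrow> a \<bullet> v \<le> c" and eq: "a \<bullet> w = c"
  shows "w \<in> convex hull {v \<in> V. a \<bullet> v = c}"
proof -
  obtain \<mu> where \<mu>: "\<forall>v\<in>V. 0 \<le> \<mu> v" "sum \<mu> V = 1" "(\<Sum>v\<in>V. \<mu> v *\<^sub>R v) = w"
    using w by (auto simp: convex_hull_finite[OF V])
  have "(\<Sum>v\<in>V. \<mu> v * (c - a \<bullet> v)) = c * sum \<mu> V - a \<bullet> (\<Sum>v\<in>V. \<mu> v *\<^sub>R v)"
    by (simp add: inner_sum_right sum_subtractf algebra_simps sum_distrib_left)
  also have "\<dots> = 0" using \<mu> eq by simp
  finally have "\<forall>v\<in>V. \<mu> v * (c - a \<bullet> v) = 0"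
    using V \<mu>(1) le by (subst (asm) sum_nonneg_eq_0_iff) auto
  then have zero: "\<mu> v = 0" if "v \<in> V - {v \<in> V. a \<bullet> v = c}" for v using that by auto
  have "sum \<mu> {v \<in> V. a \<bullet> v = c} = 1"
    using \<mu>(2) sum.mono_neutral_left[OF V, of "{v \<in> V. a \<bullet> v = c}" \<mu>] zero by auto
  moreover have "(\<Sum>v\<in>{v \<in> V. a \<bullet> v = c}. \<mu> v *\<^sub>R v) = w"
    using \<mu>(3) sum.mono_neutral_left[OF V, of "{v \<in> V. a \<bullet> v = c}" "\<lambda>v. \<mu> v *\<^sub>R v"] zero by auto
  moreover have "finite {v \<in> V. a \<bullet> v = c}" using V by simp
  ultimately show ?thesis using \<mu>(1) by (auto simp: convex_hull_finite)
qed

text \<open>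
  For a fixed \<open>W \<subseteq> V\<close> suppose that no \<open>b\<close> in the dual ball equals \<open>1\<close> on all of \<open>W\<close>. Then the sum of
  the defects \<open>1 - a \<bullet> v\<close> over \<open>v \<in> W\<close> is positive on the compact dual ball, hence bounded below, and
  some defect is always large. As there are finitely many \<open>W\<close>, one threshold serves for all.
\<close>

lemma near_maximisers_exact:
  fixes V :: "'e::euclidean_space set"
  assumes V: "finite V" and bd: "bounded {a. \<forall>v\<in>V. a \<bullet> v \<le> 1}"
  obtains \<delta> :: real where "\<delta> > 0" "\<forall>a. (\<forall>v\<in>V. a \<bullet> v \<le> 1) \<longrightarrow>
    (\<exists>b. (\<forall>v\<in>V. b \<bullet> v \<le> 1) \<and> (\<forall>v\<in>V. a \<bullet> v > 1 - \<delta> \<longrightarrow> b \<bullet> v = 1))"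
proof -
  define P where "P = {a. \<forall>v\<in>V. a \<bullet> v \<le> 1}"
  have "P = (\<Inter>v\<in>V. {a. v \<bullet> a \<le> 1})" by (auto simp: P_def inner_commute)
  then have "closed P" by (auto intro!: closed_INT closed_halfspace_le)
  then have cP: "compact P" using bd by (simp add: P_def compact_eq_bounded_closed)
  have zP: "0 \<in> P" by (simp add: P_def)
  have "\<exists>\<delta>>0. (\<exists>a\<in>P. \<forall>v\<in>W. a \<bullet> v > 1 - \<delta>) \<longrightarrow> (\<exists>b\<in>P. \<forall>v\<in>W. b \<bullet> v = 1)" if W: "W \<in> Pow V" for W
  proof (cases "\<exists>b\<in>P. \<forall>v\<in>W. b \<bullet> v = 1")
    case True
    then show ?thesis using zero_less_one by blast
  next
    case False
    have fW: "finite W" using W V finite_subset by blast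
    have "continuous_on P (\<lambda>a. \<Sum>v\<in>W. 1 - a \<bullet> v)" by (intro continuous_intros)
    then obtain m where m: "m \<in> P" "\<And>a. a \<in> P \<Longrightarrow> (\<Sum>v\<in>W. 1 - m \<bullet> v) \<le> (\<Sum>v\<in>W. 1 - a \<bullet> v)"
      using continuous_attains_inf[OF cP] zP by blast
    have pos: "(\<Sum>v\<in>W. 1 - m \<bullet> v) > 0"
    proof -
      have nn: "\<forall>v\<in>W. 0 \<le> 1 - m \<bullet> v" using m W by (auto simp: P_def)
      have "(\<Sum>v\<in>W. 1 - m \<bullet> v) \<noteq> 0"
      proof
        assume "(\<Sum>v\<in>W. 1 - m \<bullet> v) = 0"
        then have "\<forall>v\<in>W. m \<bullet> v = 1"
          using sum_nonneg_eq_0_iff[OF fW, of "\<lambda>v. 1 - m \<bullet> v"] nn by simp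
        then show False using False m(1) by blast
      qed
      moreover have "(\<Sum>v\<in>W. 1 - m \<bullet> v) \<ge> 0" using nn by (simp add: sum_nonneg)
      ultimately show ?thesis by simp
    qed
    \<comment> \<open>The summand 1 makes the contradiction below strict.\<close>
    define \<delta> where "\<delta> = (\<Sum>v\<in>W. 1 - m \<bullet> v) / (card W + 1)"
    have \<delta>: "\<delta> > 0" using pos by (simp add: \<delta>_def)
    have "\<not> (\<forall>v\<in>W. a \<bullet> v > 1 - \<delta>)" if a: "a \<in> P" for a
    proof
      assume *: "\<forall>v\<in>W. a \<bullet> v > 1 - \<delta>"
      have "(\<Sum>v\<in>W. 1 - m \<bullet> v) \<le> (\<Sum>v\<in>W. 1 - a \<bullet> v)" using m a by blast
      also have "\<dots> \<le> (\<Sum>v\<in>W. \<delta>)" using * by (intro sum_mono) (auto simp: less_imp_le algebra_simps)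
      also have "\<dots> < (card W + 1) * \<delta>" using \<delta> by (simp add: algebra_simps)
      also have "\<dots> = (\<Sum>v\<in>W. 1 - m \<bullet> v)" by (simp add: \<delta>_def)
      finally show False by simp
    qed
    then show ?thesis using \<delta> by blast
  qed
  then have "\<forall>W\<in>Pow V. \<exists>\<delta>>0. (\<exists>a\<in>P. \<forall>v\<in>W. a \<bullet> v > 1 - \<delta>) \<longrightarrow> (\<exists>b\<in>P. \<forall>v\<in>W. b \<bullet> v = 1)" by blast
  then obtain \<delta> where \<delta>: "\<forall>W\<in>Pow V. \<delta> W > 0 \<and> ((\<exists>a\<in>P. \<forall>v\<in>W. a \<bullet> v > 1 - \<delta> W) \<longrightarrow> (\<exists>b\<in>P. \<forall>v\<in>W. b \<bullet> v = 1))"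
    by (rule bchoice[THEN exE]) blast
  define \<delta>0 where "\<delta>0 = Min (\<delta> ` Pow V)"
  have \<delta>0: "\<delta>0 \<le> \<delta> W" if "W \<in> Pow V" for W using V that by (simp add: \<delta>0_def)
  have "\<delta>0 \<in> \<delta> ` Pow V" unfolding \<delta>0_def using V by (intro Min_in) auto
  then have "\<delta>0 > 0" using \<delta> by auto
  show ?thesis
  proof (rule that[OF \<open>\<delta>0 > 0\<close>], intro allI impI)
    fix a assume "\<forall>v\<in>V. a \<bullet> v \<le> 1"
    then have a: "a \<in> P" by (simp add: P_def)
    define W where "W = {v \<in> V. a \<bullet> v > 1 - \<delta>0}"
    have W: "W \<in> Pow V" by (auto simp: W_def)
    have "\<forall>v\<in>W. a \<bullet> v > 1 - \<delta> W" using \<delta>0[OF W] by (auto simp: W_def)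
    then obtain b where "b \<in> P" "\<forall>v\<in>W. b \<bullet> v = 1" using \<delta> W a by blast
    then show "\<exists>b. (\<forall>v\<in>V. b \<bullet> v \<le> 1) \<and> (\<forall>v\<in>V. a \<bullet> v > 1 - \<delta>0 \<longrightarrow> b \<bullet> v = 1)"
      by (auto simp: P_def W_def)
  qed
qed

lemma Max_image_diff_le:
  fixes f g :: "'i \<Rightarrow> real"
  assumes "finite V" "V \<noteq> {}"
  shows "\<bar>Max (f ` V) - Max (g ` V)\<bar> \<le> (\<Sum>v\<in>V. \<bar>f v - g v\<bar>)"
proof -
  have *: "Max (f ` V) \<le> Max (g ` V) + (\<Sum>v\<in>V. \<bar>f v - g v\<bar>)" for f g :: "'i \<Rightarrow> real"
  proof -
    have "f v \<le> Max (g ` V) + (\<Sum>v\<in>V. \<bar>f v - g v\<bar>)" if v: "v \<in> V" for v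
    proof -
      have "\<bar>f v - g v\<bar> \<le> (\<Sum>v\<in>V. \<bar>f v - g v\<bar>)" using v assms by (intro member_le_sum) auto
      moreover have "g v \<le> Max (g ` V)" using v assms by simp
      ultimately show ?thesis by linarith
    qed
    then show ?thesis using assms by simp
  qed
  have "(\<Sum>v\<in>V. \<bar>f v - g v\<bar>) = (\<Sum>v\<in>V. \<bar>g v - f v\<bar>)" by (simp add: abs_minus_commute)
  then show ?thesis using *[of f g] *[of g f] by linarith
qed

section \<open>Exceptional null sets\<close>

lemma interval_sets_lebesgue: "is_interval I \<Longrightarrow> (I :: real set) \<in> sets lebesgue"
  by (simp add: real_interval_borel_measurable sets_completionI_sets)

lemma AE_lebesgue_on_exceptional_set:
  fixes I :: "real set"
  assumes I: "is_interval I" and ae: "AE t in lebesgue_on I. P t"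
  obtains S where "negligible S" "\<And>t. t \<in> I - S \<Longrightarrow> P t"
proof -
  have "I \<in> sets lebesgue" using I by (rule interval_sets_lebesgue)
  then have "AE t in lebesgue. t \<in> I \<longrightarrow> P t" using ae by (simp add: AE_restrict_space_iff)
  then obtain S where "S \<in> null_sets lebesgue" "{t. \<not> (t \<in> I \<longrightarrow> P t)} \<subseteq> S"
    by (auto simp: eventually_ae_filter)
  then show ?thesis using that[of S] by (auto simp: negligible_iff_null_sets)
qed

lemma countable_imp_negligible: "countable Z \<Longrightarrow> negligible (Z :: real set)"
  by (simp add: negligible_iff_null_sets countable_imp_null_set_lborel null_sets_completionI)

text \<open>
  Where two functions agree with different derivatives, their difference has a simple zero, and simple
  zeros are isolated.
\<close>

lemma negligible_derivative_mismatch: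
  fixes f g :: "real \<Rightarrow> real"
  shows "negligible {t \<in> I. f t = g t \<and> (\<exists>D E. (f has_vector_derivative D) (at t within I) \<and>
    (g has_vector_derivative E) (at t within I) \<and> D \<noteq> E)}"
proof (rule countable_imp_negligible, rule countable_isolated_points)
  fix t assume "t \<in> {t \<in> I. f t = g t \<and> (\<exists>D E. (f has_vector_derivative D) (at t within I) \<and>
    (g has_vector_derivative E) (at t within I) \<and> D \<noteq> E)}" (is "_ \<in> ?Z")
  then obtain D E where t: "t \<in> I" "f t = g t" and D: "(f has_vector_derivative D) (at t within I)"
    "(g has_vector_derivative E) (at t within I)" "D \<noteq> E" by blast
  have "((\<lambda>s. f s - g s) has_vector_derivative D - E) (at t within I)"
    using D by (intro has_vector_derivative_diff)
  moreover have "\<bar>D - E\<bar> / 2 > 0" using D by simp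
  ultimately obtain d where d: "d > 0" "\<forall>s\<in>I. norm (s - t) < d \<longrightarrow>
      norm (f s - g s - (f t - g t) - (s - t) *\<^sub>R (D - E)) \<le> \<bar>D - E\<bar> / 2 * norm (s - t)"
    unfolding has_vector_derivative_def has_derivative_within_alt by blast
  show "\<exists>d>0. \<forall>s\<in>?Z. \<bar>s - t\<bar> < d \<longrightarrow> s = t"
  proof (intro exI[of _ d] conjI ballI impI d(1))
    fix s assume s: "s \<in> ?Z" "\<bar>s - t\<bar> < d"
    then have "norm (f s - g s - (f t - g t) - (s - t) *\<^sub>R (D - E)) \<le> \<bar>D - E\<bar> / 2 * norm (s - t)"
      using d(2) by auto
    then have "\<bar>s - t\<bar> * \<bar>D - E\<bar> \<le> \<bar>D - E\<bar> / 2 * \<bar>s - t\<bar>" using s t by (simp add: abs_mult)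
    then show "s = t" using D(3) by (simp add: mult.commute)
  qed
qed

section \<open>Norms and subgradients of the energy\<close>

context finsler_lie_group
begin

lemma N_zero: "N 0 = 0" and N_minus: "N (- v) = N v" and N_nonneg: "0 \<le> N v"
proof -
  show z: "N 0 = 0" using norm_eq_0 by simp
  show m: "N (- v) = N v" for v using norm_scale[of "-1" v] by simp
  show "0 \<le> N v" using norm_triangle[of v "- v"] z m by simp
qed

lemma N_pos: "v \<noteq> 0 \<Longrightarrow> 0 < N v"
  using N_nonneg[of v] norm_eq_0[of v] by linarith

lemma N_le_norm: obtains C where "C > 0" "\<And>v. N v \<le> C * norm v"
proof -
  have sum: "N (\<Sum>i\<in>S. f i) \<le> (\<Sum>i\<in>S. N (f i))" for f :: "'e \<Rightarrow> 'e" and S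
    by (induction S rule: infinite_finite_induct) (auto simp: N_zero intro: order_trans[OF norm_triangle])
  define C where "C = (\<Sum>i\<in>Basis. N i) + 1"
  have "C > 0" using sum_nonneg[of Basis N] N_nonneg by (simp add: C_def add_nonneg_pos)
  moreover have "N v \<le> C * norm v" for v
  proof -
    have "N v = N (\<Sum>i\<in>Basis. (v \<bullet> i) *\<^sub>R i)" by (simp add: euclidean_representation)
    also have "\<dots> \<le> (\<Sum>i\<in>Basis. N ((v \<bullet> i) *\<^sub>R i))" by (rule sum)
    also have "\<dots> \<le> (\<Sum>i\<in>Basis. norm v * N i)"
      using N_nonneg by (intro sum_mono) (auto simp: norm_scale Basis_le_norm intro!: mult_right_mono)
    also have "\<dots> = norm v * sum N Basis" by (simp add: sum_distrib_left)
    also have "\<dots> \<le> C * norm v" by (simp add: C_def algebra_simps)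
    finally show ?thesis .
  qed
  ultimately show ?thesis using that by blast
qed

lemma norm_le_N:
  assumes "bounded {v. N v \<le> 1}"
  obtains K where "K > 0" "\<And>v. norm v \<le> K * N v"
proof -
  obtain K where K: "K > 0" "\<And>v. N v \<le> 1 \<Longrightarrow> norm v \<le> K"
    using assms unfolding bounded_pos by auto
  have "norm v \<le> K * N v" for v
  proof (cases "v = 0")
    case False
    then have p: "N v > 0" by (rule N_pos)
    then have "N ((1 / N v) *\<^sub>R v) \<le> 1" by (simp add: norm_scale)
    then have "norm ((1 / N v) *\<^sub>R v) \<le> K" by (rule K)
    then show ?thesis using p by (simp add: field_simps)
  qed (simp add: N_zero)
  then show ?thesis using that K by blast
qed

text \<open>
  The value at \<open>u\<close> comes from testing the subgradient inequality with multiples \<open>(1 + s) u\<close>: the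
  linear term in \<open>s\<close> has to vanish. The bound at \<open>v\<close> comes from testing it with \<open>s v\<close> and
  optimising in \<open>s\<close>.
\<close>

lemma subdifferential_energy:
  assumes "\<eta> \<in> subdifferential (energy N) u"
  shows "linear \<eta>" "\<eta> u = (N u)\<^sup>2" "\<eta> v \<le> N u * N v"
proof -
  show lin: "linear \<eta>" using assms by (simp add: subdifferential_def)
  have sub: "\<eta> (v - u) \<le> 1 / 2 * (N v)\<^sup>2 - 1 / 2 * (N u)\<^sup>2" for v
    using assms by (simp add: subdifferential_def energy_def)
  define n where "n = N u"
  have n: "n \<ge> 0" using N_nonneg by (simp add: n_def)
  define X where "X = \<eta> u - n\<^sup>2"
  define q where "q = n\<^sup>2 / 2"
  have q: "q \<ge> 0" by (simp add: q_def)
  have X: "s * X \<le> s\<^sup>2 * q" for s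
  proof -
    have "\<eta> ((1 + s) *\<^sub>R u - u) \<le> 1 / 2 * (N ((1 + s) *\<^sub>R u))\<^sup>2 - 1 / 2 * n\<^sup>2"
      unfolding n_def by (rule sub)
    moreover have "(1 + s) *\<^sub>R u - u = s *\<^sub>R u" by (simp add: algebra_simps)
    ultimately have "s * \<eta> u \<le> 1 / 2 * ((1 + s)\<^sup>2 * n\<^sup>2) - 1 / 2 * n\<^sup>2"
      using linear_cmul[OF lin, of s u] by (simp add: norm_scale power_mult_distrib n_def)
    then show ?thesis by (simp add: X_def q_def power2_eq_square algebra_simps)
  qed
  define s where "s = X / (q + 1)"
  have Xs: "X = s * (q + 1)" using q by (simp add: s_def)
  have "s\<^sup>2 \<le> 0" using X[of s] by (simp add: Xs power2_eq_square algebra_simps)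
  then have "X = 0" by (simp add: Xs)
  then show eq: "\<eta> u = (N u)\<^sup>2" by (simp add: X_def n_def)
  have Y: "s * \<eta> v \<le> 1 / 2 * (s * N v)\<^sup>2 + 1 / 2 * n\<^sup>2" for s
    using sub[of "s *\<^sub>R v"] linear_diff[OF lin, of "s *\<^sub>R v" u] linear_cmul[OF lin, of s v] eq
    by (simp add: norm_scale power_mult_distrib n_def)
  show "\<eta> v \<le> N u * N v"
  proof (cases "v = 0")
    case True
    then show ?thesis using linear_0[OF lin] N_zero by simp
  next
    case False
    then have p: "N v > 0" by (rule N_pos)
    show ?thesis
    proof (cases "n = 0")
      case True
      have "\<eta> v \<le> 0"
      proof (rule ccontr)
        assume "\<not> \<eta> v \<le> 0"
        then have pos: "\<eta> v > 0" by simp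
        \<comment> \<open>The minimiser of \<open>s\<^sup>2 (N v)\<^sup>2 / 2 - s \<eta> v\<close>.\<close>
        define s where "s = \<eta> v / (N v)\<^sup>2"
        have s: "s > 0" using pos p by (simp add: s_def)
        have "s * \<eta> v \<le> s * (1 / 2 * (s * (N v)\<^sup>2))"
          using Y[of s] True by (simp add: power2_eq_square mult_ac)
        then have "\<eta> v \<le> 1 / 2 * (s * (N v)\<^sup>2)" using s by simp
        also have "\<dots> = \<eta> v / 2" using p by (simp add: s_def)
        finally show False using pos by simp
      qed
      then show ?thesis using True by (simp add: n_def)
    next
      case False
      then have np: "n > 0" using n by simp
      have "n / N v * \<eta> v \<le> n\<^sup>2" using Y[of "n / N v"] p by simp
      then have "n * \<eta> v \<le> n * (n * N v)" using p by (simp add: power2_eq_square field_simps)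
      then show ?thesis using np by (simp add: n_def)
    qed
  qed
qed

end

section \<open>Momenta along a normal curve\<close>

text \<open>
  The data of a normal curve, with one exceptional null set \<open>S\<close> for the existence of the velocity and
  for the normality condition. The bracket \<open>B\<close> enters as a parameter because bounds on it must be
  chosen before the curve is given.
\<close>

locale polyhedral_normal_curve = finsler_lie_group G T A N
  for G :: "('a, 'm) monoid_scheme" (structure)
    and T :: "'a topology" and A :: "('a, 'e::euclidean_space) chart set" and N :: "'e \<Rightarrow> real" +
  fixes V :: "'e set" and B :: "'e \<Rightarrow> 'e \<Rightarrow> 'e"
    and I :: "real set" and \<gamma> :: "real \<Rightarrow> 'a" and u :: "real \<Rightarrow> 'e" and l :: "'e \<Rightarrow> real" and S :: "real set"
  assumes vertices: "finite V" "{v. N v \<le> 1} = convex hull V"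
    and bracket: "bilinear B" "\<And>w. B w w = 0"
      "\<And>v. ((\<lambda>x. Ad G A (chart_inv id_chart x) v) has_derivative (\<lambda>h. B h v)) (at id_coord)"
    and interval: "is_interval I"
    and curve: "abs_continuous_curve T A I \<gamma>"
    and l_linear: "linear l"
    and exceptional: "negligible S"
    and velocity: "\<And>t. t \<in> I - S \<Longrightarrow> \<exists>w. has_velocity A \<gamma> I t w \<and>
        u t = tangent_map A A (\<lambda>x. inv (\<gamma> t) \<otimes> x) (\<gamma> t) w"
    and normality: "\<And>t. t \<in> I - S \<Longrightarrow> l \<circ> Ad G A (\<gamma> t) \<in> subdifferential (energy N) (u t)"
begin

definition momentum :: "'e \<Rightarrow> real \<Rightarrow> real" where
  "momentum v t = l (Ad G A (\<gamma> t) v)"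

text \<open>
  The dual norm of the covector \<open>\<lambda> \<circ> Ad\<^bsub>\<gamma>(t)\<^esub>\<close>: a linear function attains its maximum over the unit ball at
  one of the points whose convex hull it is.
\<close>

definition dual_norm :: "real \<Rightarrow> real" where
  "dual_norm t = Max ((\<lambda>v. momentum v t) ` V)"

lemma V_nonempty: "V \<noteq> {}"
  using vertices(2) N_zero by (metis (mono_tags, lifting) convex_hull_empty empty_iff mem_Collect_eq zero_le_one)

lemma N_vertex: "v \<in> V \<Longrightarrow> N v \<le> 1"
  using vertices(2) hull_subset[of V convex] by blast

lemma curve_continuous: "continuous_map (top_of_set I) T \<gamma>"
  using curve by (simp add: abs_continuous_curve_def)

lemma momentum_linear: "t \<in> I \<Longrightarrow> linear (\<lambda>v. momentum v t)"
proof -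
  assume "t \<in> I"
  then have "\<gamma> t \<in> carrier G" using curve_continuous carrier by (auto simp: continuous_map_def)
  from linear_compose[OF Ad_linear[OF this] l_linear] show ?thesis
    by (simp add: momentum_def[abs_def] o_def)
qed

lemma momentum_subdifferential:
  assumes "t \<in> I - S"
  shows "momentum (u t) t = (N (u t))\<^sup>2" "momentum v t \<le> N (u t) * N v"
  using subdifferential_energy[OF normality[OF assms]] by (simp_all add: momentum_def)

lemma momentum_has_derivative:
  assumes "t \<in> I - S"
  shows "((\<lambda>s. momentum v s) has_vector_derivative momentum (B (u t) v) t) (at t within I)"
proof -
  obtain w where "has_velocity A \<gamma> I t w" "u t = tangent_map A A (\<lambda>x. inv (\<gamma> t) \<otimes> x) (\<gamma> t) w"
    using velocity[OF assms] by blast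
  then show ?thesis
    unfolding momentum_def using Ad_curve_derivative[OF curve_continuous l_linear _ bracket(3)] assms by blast
qed

lemma momentum_locally_abs_continuous:
  assumes "t \<in> I"
  shows "\<exists>d>0. \<forall>a b. a \<le> t \<and> t \<le> b \<and> b - a < d \<and> {a..b} \<subseteq> I \<longrightarrow> abs_continuous_on {a..b} (momentum v)"
  unfolding momentum_def[abs_def] by (rule Ad_curve_abs_continuous[OF curve l_linear assms])

lemma active_vertices:
  assumes t: "t \<in> I - S" and pos: "N (u t) > 0"
  shows "(1 / N (u t)) *\<^sub>R u t \<in> convex hull {v \<in> V. momentum v t = N (u t)}"
proof -
  let ?w = "(1 / N (u t)) *\<^sub>R u t"
  have lin: "linear (\<lambda>v. momentum v t)" using momentum_linear t by blast
  then obtain a where a: "\<And>v. momentum v t = a \<bullet> v" using linear_functional_inner by blast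
  have "momentum ?w t = N (u t)"
    using linear_cmul[OF lin] momentum_subdifferential(1)[OF t] pos by (simp add: power2_eq_square)
  moreover have "?w \<in> convex hull V"
    unfolding vertices(2)[symmetric] using pos by (simp add: norm_scale)
  moreover have "momentum v t \<le> N (u t)" if "v \<in> V" for v
    using momentum_subdifferential(2)[OF t, of v] N_vertex[OF that] N_nonneg[of "u t"]
      mult_left_mono[of "N v" 1 "N (u t)"] by simp
  ultimately show ?thesis
    using convex_hull_active[OF vertices(1), of ?w a "N (u t)"] unfolding a by blast
qed

lemma dual_norm_eq_N:
  assumes t: "t \<in> I - S"
  shows "dual_norm t = N (u t)"
proof -
  have le: "momentum v t \<le> N (u t)" if "v \<in> V" for v
    using momentum_subdifferential(2)[OF t, of v] N_vertex[OF that] N_nonneg[of "u t"]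
      mult_left_mono[of "N v" 1 "N (u t)"] by simp
  have "\<exists>v\<in>V. momentum v t = N (u t)"
  proof (cases "N (u t) = 0")
    case True
    have lin: "linear (\<lambda>v. momentum v t)" using momentum_linear t by blast
    obtain v where v: "v \<in> V" using V_nonempty by blast
    have "momentum v t \<le> 0" "momentum (- v) t \<le> 0"
      using momentum_subdifferential(2)[OF t] True by (metis mult_zero_left)+
    then have "momentum v t = 0" using linear_neg[OF lin, of v] by simp
    then show ?thesis using v True by auto
  next
    case False
    then have "N (u t) > 0" using N_nonneg[of "u t"] by simp
    from active_vertices[OF t this] have "{v \<in> V. momentum v t = N (u t)} \<noteq> {}" by (metis convex_hull_empty empty_iff)
    then show ?thesis by blast
  qed
  then show ?thesis unfolding dual_norm_def
    using le vertices(1) by (intro Max_eqI) (auto intro: rev_image_eqI)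
qed

text \<open>
  The times at which the pointwise maximum of the momenta may fail to be differentiable although each
  of them is.
\<close>

definition mismatch :: "real set" where
  "mismatch = (\<Union>v\<in>V. \<Union>w\<in>V. {t \<in> I. momentum v t = momentum w t \<and>
    (\<exists>D E. (momentum v has_vector_derivative D) (at t within I) \<and>
      (momentum w has_vector_derivative E) (at t within I) \<and> D \<noteq> E)})"

lemma mismatchI:
  assumes "v \<in> V" "w \<in> V" "t \<in> I" "momentum v t = momentum w t"
    "(momentum v has_vector_derivative D) (at t within I)"
    "(momentum w has_vector_derivative E) (at t within I)" "D \<noteq> E"
  shows "t \<in> mismatch"
  unfolding mismatch_def using assms by (intro UN_I CollectI conjI exI)

lemma negligible_mismatch: "negligible mismatch"
  unfolding mismatch_def using vertices(1) negligible_derivative_mismatch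
  by (intro negligible_Union) auto

text \<open>
  Outside \<open>mismatch\<close> all active momenta have the same derivative. The normalised control is a convex
  combination of the active vertices, so this derivative is also the value of
  \<open>x \<mapsto> momentum (B (u t) x) t\<close> at the normalised control, where \<open>B\<close> vanishes.
\<close>

lemma active_derivative_zero:
  assumes t: "t \<in> I - (S \<union> mismatch)" and v: "v \<in> V" "momentum v t = dual_norm t"
  shows "momentum (B (u t) v) t = 0"
proof (cases "u t = 0")
  case True
  have "linear (\<lambda>v. momentum v t)" using momentum_linear t by blast
  from linear_0[OF this] show ?thesis using bilinear_lzero[OF bracket(1)] True by simp
next
  case False
  then have pos: "N (u t) > 0" by (rule N_pos)
  have t': "t \<in> I - S" using t by blast
  let ?L = "\<lambda>x. momentum (B (u t) x) t"
  have lin: "linear ?L"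
    using linear_compose[OF _ momentum_linear[of t], of "B (u t)"] bracket(1) t by (simp add: bilinear_def o_def)
  have same: "?L w = ?L v" if "w \<in> V" "momentum w t = N (u t)" for w
  proof (rule ccontr)
    assume ne: "?L w \<noteq> ?L v"
    have "momentum w t = momentum v t" using that v dual_norm_eq_N[OF t'] by simp
    then have "t \<in> mismatch"
      using mismatchI[OF that(1) v(1) _ _ momentum_has_derivative[OF t', of w] momentum_has_derivative[OF t', of v] ne] t'
      by blast
    then show False using t by blast
  qed
  obtain a where a: "\<And>x. ?L x = a \<bullet> x" using linear_functional_inner[OF lin] by blast
  have "convex hull {v \<in> V. momentum v t = N (u t)} \<subseteq> {x. a \<bullet> x = ?L v}"
    using same a by (intro hull_minimal) (auto simp: convex_hyperplane)
  then have "?L ((1 / N (u t)) *\<^sub>R u t) = ?L v" using active_vertices[OF t' pos] a by auto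
  moreover have "?L ((1 / N (u t)) *\<^sub>R u t) = (1 / N (u t)) * ?L (u t)" using linear_cmul[OF lin] by simp
  moreover have "?L (u t) = 0" using bracket(2) linear_0[OF momentum_linear] t by simp
  ultimately show ?thesis by simp
qed

text \<open>
  Near \<open>t\<close> the inactive momenta stay below the maximum by continuity, and the active ones move by
  \<open>o(s - t)\<close>.
\<close>

lemma dual_norm_slope:
  assumes t: "t \<in> I - (S \<union> mismatch)" and \<epsilon>: "\<epsilon> > 0"
  shows "\<exists>d>0. \<forall>s\<in>I. \<bar>s - t\<bar> < d \<longrightarrow> \<bar>dual_norm s - dual_norm t\<bar> \<le> \<epsilon> * \<bar>s - t\<bar>"
proof -
  have t': "t \<in> I - S" using t by blast
  have le: "momentum v s \<le> dual_norm s" if "v \<in> V" for v s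
    using that vertices(1) by (simp add: dual_norm_def)
  have "\<exists>d>0. \<forall>s\<in>I. \<bar>s - t\<bar> < d \<longrightarrow> momentum v s \<le> dual_norm t + \<epsilon> * \<bar>s - t\<bar> \<and>
      (momentum v t = dual_norm t \<longrightarrow> dual_norm t - \<epsilon> * \<bar>s - t\<bar> \<le> momentum v s)" if v: "v \<in> V" for v
  proof (cases "momentum v t = dual_norm t")
    case True
    have "((\<lambda>s. momentum v s) has_vector_derivative 0) (at t within I)"
      using momentum_has_derivative[OF t', of v] active_derivative_zero[OF t v True] by simp
    then obtain d where "d > 0" "\<forall>s\<in>I. norm (s - t) < d \<longrightarrow>
        norm (momentum v s - momentum v t - (s - t) *\<^sub>R 0) \<le> \<epsilon> * norm (s - t)"
      unfolding has_vector_derivative_def has_derivative_within_alt using \<epsilon> by blast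
    then show ?thesis using True by (intro exI[of _ d]) (auto simp: abs_le_iff)
  next
    case False
    then have less: "momentum v t < dual_norm t" using le[OF v, of t] by simp
    have "continuous (at t within I) (momentum v)"
      using momentum_has_derivative[OF t', of v] has_vector_derivative_continuous by blast
    then have "\<exists>d>0. \<forall>s\<in>I. dist s t < d \<longrightarrow> dist (momentum v s) (momentum v t) < dual_norm t - momentum v t"
      unfolding continuous_within_eps_delta using less by simp
    then obtain d where "d > 0"
        "\<forall>s\<in>I. dist s t < d \<longrightarrow> dist (momentum v s) (momentum v t) < dual_norm t - momentum v t"
      by blast
    then show ?thesis using False \<epsilon> by (intro exI[of _ d]) (auto simp: dist_real_def add_increasing2 less_imp_le)
  qed
  then have "\<forall>v\<in>V. \<exists>d>0. \<forall>s\<in>I. \<bar>s - t\<bar> < d \<longrightarrow> momentum v s \<le> dual_norm t + \<epsilon> * \<bar>s - t\<bar> \<and>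
      (momentum v t = dual_norm t \<longrightarrow> dual_norm t - \<epsilon> * \<bar>s - t\<bar> \<le> momentum v s)" by blast
  then obtain d where d: "\<forall>v\<in>V. d v > 0 \<and> (\<forall>s\<in>I. \<bar>s - t\<bar> < d v \<longrightarrow> momentum v s \<le> dual_norm t + \<epsilon> * \<bar>s - t\<bar> \<and>
      (momentum v t = dual_norm t \<longrightarrow> dual_norm t - \<epsilon> * \<bar>s - t\<bar> \<le> momentum v s))"
    by (rule bchoice[THEN exE]) blast
  define d0 where "d0 = Min (d ` V)"
  have d0: "d0 > 0" "\<And>v. v \<in> V \<Longrightarrow> d0 \<le> d v" using d vertices(1) V_nonempty by (auto simp: d0_def)
  have "dual_norm t \<in> (\<lambda>v. momentum v t) ` V"
    unfolding dual_norm_def using vertices(1) V_nonempty by (intro Max_in) auto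
  then obtain w where w: "w \<in> V" "momentum w t = dual_norm t" by auto
  show ?thesis
  proof (intro exI[of _ d0] conjI d0(1) ballI impI)
    fix s assume s: "s \<in> I" "\<bar>s - t\<bar> < d0"
    have "momentum v s \<le> dual_norm t + \<epsilon> * \<bar>s - t\<bar>" if "v \<in> V" for v
      using d d0(2)[OF that] s that by force
    then have "dual_norm s \<le> dual_norm t + \<epsilon> * \<bar>s - t\<bar>"
      unfolding dual_norm_def[of s] using vertices(1) V_nonempty by (intro Max.boundedI) auto
    moreover have "dual_norm t - \<epsilon> * \<bar>s - t\<bar> \<le> momentum w s"
      using d d0(2)[OF w(1)] s w by force
    ultimately show "\<bar>dual_norm s - dual_norm t\<bar> \<le> \<epsilon> * \<bar>s - t\<bar>" using le[OF w(1), of s] by linarith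
  qed
qed

text \<open>
  Conservation of the Hamiltonian: together with \<open>dual_norm_eq_N\<close> it says that a normal curve has
  constant speed.
\<close>

lemma dual_norm_constant:
  assumes "a \<in> I" "b \<in> I"
  shows "dual_norm a = dual_norm b"
proof -
  have *: "dual_norm a = dual_norm b" if ab: "a \<le> b" "{a..b} \<subseteq> I" for a b
  proof -
    have "{a..b} \<subseteq> I \<longrightarrow> dual_norm a = dual_norm b"
    proof (rule Bolzano[OF ab(1)])
      fix a b c assume H: "{a..b} \<subseteq> I \<longrightarrow> dual_norm a = dual_norm b" "{b..c} \<subseteq> I \<longrightarrow> dual_norm b = dual_norm c"
        "a \<le> b" "b \<le> (c::real)"
      then have "{a..b} \<subseteq> {a..c}" "{b..c} \<subseteq> {a..c}" by auto
      then show "{a..c} \<subseteq> I \<longrightarrow> dual_norm a = dual_norm c" using H by (metis order_trans)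
    next
      fix x assume "a \<le> x" "x \<le> b"
      then have x: "x \<in> I" using ab by auto
      have "\<forall>v\<in>V. \<exists>d>0. \<forall>a b. a \<le> x \<and> x \<le> b \<and> b - a < d \<and> {a..b} \<subseteq> I \<longrightarrow> abs_continuous_on {a..b} (momentum v)"
        using momentum_locally_abs_continuous[OF x] by blast
      then obtain d where d: "\<forall>v\<in>V. d v > 0 \<and> (\<forall>a b. a \<le> x \<and> x \<le> b \<and> b - a < d v \<and> {a..b} \<subseteq> I \<longrightarrow>
          abs_continuous_on {a..b} (momentum v))"
        by (rule bchoice[THEN exE]) blast
      define d0 where "d0 = Min (d ` V)"
      have d0: "d0 > 0" "\<And>v. v \<in> V \<Longrightarrow> d0 \<le> d v" using d vertices(1) V_nonempty by (auto simp: d0_def)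
      show "\<exists>d>0. \<forall>a b. a \<le> x \<and> x \<le> b \<and> b - a < d \<longrightarrow> {a..b} \<subseteq> I \<longrightarrow> dual_norm a = dual_norm b"
      proof (intro exI[of _ d0] conjI d0(1) allI impI)
        fix a b assume ab: "a \<le> x \<and> x \<le> b \<and> b - a < d0" "{a..b} \<subseteq> I"
        have ac: "abs_continuous_on {a..b} (momentum v)" if "v \<in> V" for v
        proof -
          have "b - a < d v" using ab d0(2)[OF that] by linarith
          then show ?thesis using d that ab by blast
        qed
        have "abs_continuous_on {a..b} dual_norm"
        proof (rule abs_continuous_on_dominated[OF vertices(1) ac, where K = 1])
          show "norm (dual_norm s - dual_norm t) \<le> 1 * (\<Sum>v\<in>V. norm (momentum v s - momentum v t))" for s t
            unfolding dual_norm_def using Max_image_diff_le[OF vertices(1) V_nonempty] by simp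
        qed
        then have "norm (dual_norm b - dual_norm a) \<le> 0"
        proof (rule abs_continuous_increment_le[where g = "\<lambda>_. 0" and S = "S \<union> mismatch"])
          show "negligible (S \<union> mismatch)" using exceptional negligible_mismatch by simp
          fix t \<epsilon> :: real assume t: "t \<in> {a..b} - (S \<union> mismatch)" and \<epsilon>: "\<epsilon> > 0"
          then have "t \<in> I - (S \<union> mismatch)" using ab by blast
          from dual_norm_slope[OF this \<epsilon>] obtain d where
            "d > 0" "\<forall>s\<in>I. \<bar>s - t\<bar> < d \<longrightarrow> \<bar>dual_norm s - dual_norm t\<bar> \<le> \<epsilon> * \<bar>s - t\<bar>" by blast
          then show "\<exists>d>0. \<forall>s\<in>{a..b}. \<bar>s - t\<bar> < d \<longrightarrow> norm (dual_norm s - dual_norm t) \<le> (0 + \<epsilon>) * \<bar>s - t\<bar>"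
            using ab(2) by (intro exI[of _ d]) auto
        qed (use ab in auto)
        then show "dual_norm a = dual_norm b" by simp
      qed
    qed
    then show ?thesis using ab by blast
  qed
  have "{min a b..max a b} \<subseteq> I"
  proof
    fix x assume "x \<in> {min a b..max a b}"
    then show "x \<in> I" using mem_is_interval_1_I[OF interval, of a b x] mem_is_interval_1_I[OF interval, of b a x] assms
      by (auto simp: min_def max_def split: if_splits)
  qed
  then show ?thesis using *[of "min a b" "max a b"] by (auto simp: min_def max_def split: if_splits)
qed

text \<open>
  The derivative of the momentum at \<open>v\<close> is the momentum at \<open>B (u t) v\<close>, bounded by the dual norm \<open>r\<close>
  times \<open>C * r\<close>.
\<close>

lemma momentum_variation:
  assumes C: "\<And>x y. N (B x y) \<le> C * N x * N y" "C \<ge> 0" and v: "v \<in> V"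
    and ab: "a \<le> b" "{a..b} \<subseteq> I" and r: "\<And>t. t \<in> I \<Longrightarrow> dual_norm t = r"
  shows "\<bar>momentum v b - momentum v a\<bar> \<le> C * r\<^sup>2 * (b - a)"
proof -
  have slope: "\<exists>d>0. \<forall>s\<in>I. \<bar>s - t\<bar> < d \<longrightarrow> \<bar>momentum v s - momentum v t\<bar> \<le> (C * r\<^sup>2 + \<epsilon>) * \<bar>s - t\<bar>"
    if t: "t \<in> I - S" and \<epsilon>: "\<epsilon> > 0" for t \<epsilon>
  proof -
    define D where "D = momentum (B (u t) v) t"
    have Nu: "N (u t) = r" using dual_norm_eq_N[OF t] r t by simp
    have lin: "linear (\<lambda>v. momentum v t)" using momentum_linear t by blast
    have "\<bar>D\<bar> \<le> r * N (B (u t) v)"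
      using momentum_subdifferential(2)[OF t, of "B (u t) v"] momentum_subdifferential(2)[OF t, of "- B (u t) v"]
        linear_neg[OF lin, of "B (u t) v"] unfolding D_def N_minus Nu by linarith
    also have "\<dots> \<le> r * (C * r * 1)"
    proof (rule mult_left_mono)
      have "N (B (u t) v) \<le> C * r * N v" using C(1)[of "u t" v] Nu by simp
      also have "\<dots> \<le> C * r * 1" using N_vertex[OF v] C(2) N_nonneg[of "u t"] Nu by (intro mult_left_mono) auto
      finally show "N (B (u t) v) \<le> C * r * 1" .
    qed (use Nu N_nonneg[of "u t"] in simp)
    finally have Dle: "\<bar>D\<bar> \<le> C * r\<^sup>2" by (simp add: power2_eq_square mult_ac)
    have "(momentum v has_vector_derivative D) (at t within I)" using momentum_has_derivative[OF t, of v] by (simp add: D_def)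
    then obtain d where d: "d > 0" "\<forall>s\<in>I. norm (s - t) < d \<longrightarrow>
        norm (momentum v s - momentum v t - (s - t) *\<^sub>R D) \<le> \<epsilon> * norm (s - t)"
      unfolding has_vector_derivative_def has_derivative_within_alt using \<epsilon> by blast
    have "\<bar>momentum v s - momentum v t\<bar> \<le> (C * r\<^sup>2 + \<epsilon>) * \<bar>s - t\<bar>" if "s \<in> I" "\<bar>s - t\<bar> < d" for s
    proof -
      have "\<bar>momentum v s - momentum v t - (s - t) * D\<bar> \<le> \<epsilon> * \<bar>s - t\<bar>" using d(2) that by simp
      moreover have "\<bar>(s - t) * D\<bar> \<le> C * r\<^sup>2 * \<bar>s - t\<bar>"
        using Dle mult_left_mono[of "\<bar>D\<bar>" "C * r\<^sup>2" "\<bar>s - t\<bar>"] by (simp add: abs_mult mult.commute)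
      ultimately show ?thesis by (simp add: algebra_simps)
    qed
    then show ?thesis using d(1) by blast
  qed
  have "{a..b} \<subseteq> I \<longrightarrow> \<bar>momentum v b - momentum v a\<bar> \<le> C * r\<^sup>2 * (b - a)"
  proof (rule Bolzano[OF ab(1)])
    fix a b c assume H: "{a..b} \<subseteq> I \<longrightarrow> \<bar>momentum v b - momentum v a\<bar> \<le> C * r\<^sup>2 * (b - a)"
      "{b..c} \<subseteq> I \<longrightarrow> \<bar>momentum v c - momentum v b\<bar> \<le> C * r\<^sup>2 * (c - b)" "a \<le> b" "b \<le> (c::real)"
    show "{a..c} \<subseteq> I \<longrightarrow> \<bar>momentum v c - momentum v a\<bar> \<le> C * r\<^sup>2 * (c - a)"
    proof
      assume "{a..c} \<subseteq> I"
      moreover have "{a..b} \<subseteq> {a..c}" "{b..c} \<subseteq> {a..c}" using H by auto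
      ultimately have "{a..b} \<subseteq> I" "{b..c} \<subseteq> I" by blast+
      then show "\<bar>momentum v c - momentum v a\<bar> \<le> C * r\<^sup>2 * (c - a)" using H by (simp add: algebra_simps)
    qed
  next
    fix x assume "a \<le> x" "x \<le> b"
    then have x: "x \<in> I" using ab by auto
    obtain d where d: "d > 0" "\<forall>a b. a \<le> x \<and> x \<le> b \<and> b - a < d \<and> {a..b} \<subseteq> I \<longrightarrow> abs_continuous_on {a..b} (momentum v)"
      using momentum_locally_abs_continuous[OF x, of v] by blast
    show "\<exists>d>0. \<forall>a b. a \<le> x \<and> x \<le> b \<and> b - a < d \<longrightarrow> {a..b} \<subseteq> I \<longrightarrow>
        \<bar>momentum v b - momentum v a\<bar> \<le> C * r\<^sup>2 * (b - a)"
    proof (intro exI[of _ d] conjI d(1) allI impI)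
      fix a b assume ab: "a \<le> x \<and> x \<le> b \<and> b - a < d" "{a..b} \<subseteq> I"
      have "norm (momentum v b - momentum v a) \<le> C * r\<^sup>2 * (b - a)"
      proof (rule abs_continuous_increment_le[where f = "momentum v" and g = "\<lambda>_. C * r\<^sup>2" and S = S])
        show "abs_continuous_on {a..b} (momentum v)" using d(2) ab by blast
        show "((\<lambda>_. C * r\<^sup>2) has_integral C * r\<^sup>2 * (b - a)) {a..b}"
          using has_integral_const_real[of "C * r\<^sup>2" a b] ab by (simp add: mult.commute)
        fix t \<epsilon> :: real assume t: "t \<in> {a..b} - S" and \<epsilon>: "\<epsilon> > 0"
        then have "t \<in> I - S" using ab by blast
        from slope[OF this \<epsilon>] obtain d where
          "d > 0" "\<forall>s\<in>I. \<bar>s - t\<bar> < d \<longrightarrow> \<bar>momentum v s - momentum v t\<bar> \<le> (C * r\<^sup>2 + \<epsilon>) * \<bar>s - t\<bar>" by blast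
        then show "\<exists>d>0. \<forall>s\<in>{a..b}. \<bar>s - t\<bar> < d \<longrightarrow> norm (momentum v s - momentum v t) \<le> (C * r\<^sup>2 + \<epsilon>) * \<bar>s - t\<bar>"
          using ab(2) by (intro exI[of _ d]) auto
      qed (use ab C(2) exceptional in auto)
      then show "\<bar>momentum v b - momentum v a\<bar> \<le> C * r\<^sup>2 * (b - a)" by simp
    qed
  qed
  then show ?thesis using ab by blast
qed

lemma AE_exceptional: "(\<And>t. t \<in> I - S \<Longrightarrow> P t) \<Longrightarrow> AE t in lebesgue_on I. P t"
  using exceptional interval_sets_lebesgue[OF interval]
  by (auto simp: AE_restrict_space_iff negligible_iff_null_sets intro: AE_I'[of S])

lemma curve_length_eq:
  assumes r: "\<And>t. t \<in> I \<Longrightarrow> dual_norm t = r"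
  shows "curve_length N I u = ennreal r * emeasure lebesgue I"
proof -
  have "curve_length N I u = (\<integral>\<^sup>+t. ennreal r \<partial>lebesgue_on I)"
    unfolding curve_length_def
    by (intro nn_integral_cong_AE AE_exceptional) (use dual_norm_eq_N r in auto)
  also have "\<dots> = ennreal r * emeasure (lebesgue_on I) I"
    by (simp add: space_restrict_space)
  also have "emeasure (lebesgue_on I) I = emeasure lebesgue I"
    using interval_sets_lebesgue[OF interval] by (simp add: emeasure_restrict_space)
  finally show ?thesis .
qed

text \<open>
  All vertices that are active at some time are nearly maximal for the covector at a reference time
  \<open>t0\<close>, so a single \<open>b\<close> is maximal at all of them, and the face exposed by \<open>b\<close> contains the control.
\<close>

lemma short_takes_values_in_face:
  assumes C: "\<And>x y. N (B x y) \<le> C * N x * N y" "C > 0"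
    and \<delta>: "\<delta> > 0" "\<forall>a. (\<forall>v\<in>V. a \<bullet> v \<le> 1) \<longrightarrow>
    (\<exists>b. (\<forall>v\<in>V. b \<bullet> v \<le> 1) \<and> (\<forall>v\<in>V. a \<bullet> v > 1 - \<delta> \<longrightarrow> b \<bullet> v = 1))"
    and len: "0 < curve_length N I u" "curve_length N I u < ennreal (\<delta> / C)"
  shows "takes_values_in_face N I u"
proof -
  have "I \<noteq> {}"
  proof
    assume "I = {}"
    then show False using len(1) curve_length_eq[of 0] by simp
  qed
  then obtain t0 where t0: "t0 \<in> I" by blast
  define r where "r = dual_norm t0"
  have const: "dual_norm t = r" if "t \<in> I" for t unfolding r_def using that t0 by (rule dual_norm_constant)
  have length: "curve_length N I u = ennreal r * emeasure lebesgue I" using const by (rule curve_length_eq)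
  have r: "r > 0"
  proof (rule ccontr)
    assume "\<not> r > 0"
    then have "ennreal r = 0" by (simp add: ennreal_neg)
    then show False using len(1) length by simp
  qed
  have dist_less: "r * \<bar>t - t0\<bar> < \<delta> / C" if t: "t \<in> I" for t
  proof -
    have sub: "{min t t0..max t t0} \<subseteq> I"
    proof
      fix x assume "x \<in> {min t t0..max t t0}"
      then show "x \<in> I" using mem_is_interval_1_I[OF interval, of t t0 x] mem_is_interval_1_I[OF interval, of t0 t x] t t0
        by (auto simp: min_def max_def split: if_splits)
    qed
    have "ennreal (r * \<bar>t - t0\<bar>) = ennreal r * emeasure lebesgue {min t t0..max t t0}"
      using r by (simp add: ennreal_mult min_def max_def)
    also have "\<dots> \<le> curve_length N I u"
      unfolding length using sub interval_sets_lebesgue[OF interval] by (intro mult_left_mono emeasure_mono) auto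
    also have "\<dots> < ennreal (\<delta> / C)" by (rule len(2))
    finally show ?thesis using r by (simp add: ennreal_less_iff)
  qed
  have variation: "\<bar>momentum v t - momentum v t0\<bar> < r * \<delta>" if t: "t \<in> I" and v: "v \<in> V" for t v
  proof -
    have le: "\<bar>momentum v b - momentum v a\<bar> \<le> C * r\<^sup>2 * (b - a)" if "a \<le> b" "a \<in> I" "b \<in> I" for a b
    proof -
      have "{a..b} \<subseteq> I"
        using mem_is_interval_1_I[OF interval \<open>a \<in> I\<close> \<open>b \<in> I\<close>] by auto
      then show ?thesis using momentum_variation[OF C(1) _ v \<open>a \<le> b\<close>] C(2) const by simp
    qed
    have "\<bar>momentum v t - momentum v t0\<bar> \<le> C * r\<^sup>2 * \<bar>t - t0\<bar>"
      using le[of t t0] le[of t0 t] t t0 by (cases "t \<le> t0") (auto simp: abs_minus_commute)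
    also have "\<dots> = (C * r) * (r * \<bar>t - t0\<bar>)" by (simp add: power2_eq_square)
    also have "\<dots> < (C * r) * (\<delta> / C)" using dist_less[OF t] r C(2) by (intro mult_strict_left_mono) auto
    also have "\<dots> = r * \<delta>" using C(2) by simp
    finally show ?thesis .
  qed
  obtain a0 where a0: "\<And>v. momentum v t0 = a0 \<bullet> v"
    using linear_functional_inner[OF momentum_linear[OF t0]] by blast
  define a where "a = (1 / r) *\<^sub>R a0"
  have a: "a \<bullet> v = momentum v t0 / r" for v using a0 by (simp add: a_def)
  have "\<forall>v\<in>V. a \<bullet> v \<le> 1"
  proof
    fix v assume v: "v \<in> V"
    have "momentum v t0 \<le> r" using v vertices(1) by (simp add: r_def dual_norm_def)
    then show "a \<bullet> v \<le> 1" using r by (simp add: a)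
  qed
  with \<delta>(2) obtain b where b: "\<forall>v\<in>V. b \<bullet> v \<le> 1" "\<forall>v\<in>V. a \<bullet> v > 1 - \<delta> \<longrightarrow> b \<bullet> v = 1"
    by blast
  have bmax: "b \<bullet> v = 1" if t: "t \<in> I" and v: "v \<in> V" "momentum v t = r" for t v
  proof -
    have "momentum v t0 > r * (1 - \<delta>)" using variation[OF t v(1)] v(2) by (simp add: algebra_simps abs_less_iff)
    then have "a \<bullet> v > 1 - \<delta>" using r by (simp add: a pos_less_divide_eq mult.commute)
    then show ?thesis using b(2) v(1) by blast
  qed
  have "dual_norm t0 \<in> (\<lambda>v. momentum v t0) ` V"
    unfolding dual_norm_def using vertices(1) V_nonempty by (intro Max_in) auto
  then obtain v0 where "v0 \<in> V" "momentum v0 t0 = r" by (auto simp: r_def)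
  then have v0: "b \<bullet> v0 = 1" using bmax[OF t0] by blast
  have hull_le: "b \<bullet> w \<le> r" if w: "N w \<le> r" for w
  proof -
    have "N ((1 / r) *\<^sub>R w) \<le> 1" using w r by (simp add: norm_scale)
    then have "(1 / r) *\<^sub>R w \<in> convex hull V" using vertices(2) by blast
    moreover have "convex hull V \<subseteq> {x. b \<bullet> x \<le> 1}"
      using b(1) by (intro hull_minimal) (auto simp: convex_halfspace_le)
    ultimately have "b \<bullet> ((1 / r) *\<^sub>R w) \<le> 1" by blast
    then show ?thesis using r by (simp add: field_simps)
  qed
  define F where "F = {v. N v \<le> r \<and> (\<forall>w. N w \<le> r \<longrightarrow> b \<bullet> w \<le> b \<bullet> v)}"
  have "sphere_face N r F"
    unfolding sphere_face_def
  proof (intro exI[of _ "\<lambda>w. b \<bullet> w"] conjI)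
    show "linear (\<lambda>w. b \<bullet> w)" by (simp add: bounded_linear.linear bounded_linear_inner_right)
    show "(\<lambda>w. b \<bullet> w) \<noteq> (\<lambda>_. 0)" using v0 by (metis zero_neq_one)
  qed (simp add: F_def)
  moreover have "u t \<in> F" if t: "t \<in> I - S" for t
  proof -
    have Nu: "N (u t) = r" using dual_norm_eq_N[OF t] const t by simp
    have "convex hull {v \<in> V. momentum v t = N (u t)} \<subseteq> {x. b \<bullet> x = 1}"
      using bmax t Nu by (intro hull_minimal) (auto simp: convex_hyperplane)
    then have "b \<bullet> ((1 / r) *\<^sub>R u t) = 1" using active_vertices[OF t] r Nu by auto
    then have "b \<bullet> u t = r" using r by (simp add: field_simps)
    then show ?thesis using hull_le Nu by (simp add: F_def)
  qed
  then have "AE t in lebesgue_on I. u t \<in> F" by (rule AE_exceptional)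
  ultimately show ?thesis using r unfolding takes_values_in_face_def by blast
qed

end

section \<open>Short normal curves\<close>

theorem corollary1p4:
  fixes G :: "('a, 'm) monoid_scheme" and T :: "'a topology"
    and A :: "('a, 'e::euclidean_space) chart set" and N :: "'e \<Rightarrow> real"
  assumes "finsler_lie_group G T A N"
    and "polyhedral_norm N"
  shows "\<exists>L>(0::real). \<forall>(I::real set) (\<gamma>::real \<Rightarrow> 'a) (u::real \<Rightarrow> 'e).
           is_interval I \<and> normal_curve G T A N I \<gamma> u \<and>
           0 < curve_length N I u \<and> curve_length N I u < ennreal L
           \<longrightarrow> takes_values_in_face N I u"
proof -
  interpret finsler_lie_group G T A N by fact
  have poly: "polytope {v. N v \<le> 1}" using assms(2) by (simp add: polyhedral_norm_def)
  then obtain V where V: "finite V" "{v. N v \<le> 1} = convex hull V" unfolding polytope_def by blast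
  obtain C1 where C1: "C1 > 0" "\<And>v. N v \<le> C1 * norm v" using N_le_norm by blast
  obtain K where K: "K > 0" "\<And>v. norm v \<le> K * N v" using norm_le_N[OF polytope_imp_bounded[OF poly]] by blast
  obtain B :: "'e \<Rightarrow> 'e \<Rightarrow> 'e" where B: "bilinear B" "\<And>w. B w w = 0"
    "\<And>v. ((\<lambda>x. Ad G A (chart_inv id_chart x) v) has_derivative (\<lambda>h. B h v)) (at id_coord)"
    by (rule Ad_derivative_at_one, rule that, assumption+)
  obtain M where M: "M > 0" "\<And>x y. norm (B x y) \<le> M * norm x * norm y"
    using bilinear_bounded_pos[OF B(1)] by blast
  define C where "C = C1 * (M * K * K)"
  have C: "C > 0" using C1 M K by (simp add: C_def)
  have BC: "N (B x y) \<le> C * N x * N y" for x y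
  proof -
    have "N (B x y) \<le> C1 * norm (B x y)" by (rule C1)
    also have "\<dots> \<le> C1 * (M * norm x * norm y)" using M C1 by (intro mult_left_mono) auto
    also have "\<dots> \<le> C1 * (M * (K * N x) * (K * N y))"
      using K M C1 N_nonneg by (intro mult_left_mono mult_mono) auto
    finally show ?thesis by (simp add: C_def mult_ac)
  qed
  \<comment> \<open>The unit ball of the dual norm is bounded because the unit ball contains a Euclidean ball of radius \<open>1 / C1\<close>.\<close>
  have bd: "bounded {a. \<forall>v\<in>V. a \<bullet> v \<le> 1}"
    unfolding bounded_iff
  proof (intro exI[of _ C1] ballI)
    fix a assume "a \<in> {a. \<forall>v\<in>V. a \<bullet> v \<le> 1}"
    then have "convex hull V \<subseteq> {x. a \<bullet> x \<le> 1}" by (intro hull_minimal) (auto simp: convex_halfspace_le)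
    then have le: "a \<bullet> x \<le> 1" if "N x \<le> 1" for x using that V(2) by blast
    show "norm a \<le> C1"
    proof (cases "a = 0")
      case False
      then have p: "norm a > 0" by simp
      have "N ((1 / (C1 * norm a)) *\<^sub>R a) \<le> 1"
        using C1(2)[of a] C1(1) p by (simp add: norm_scale divide_simps)
      from le[OF this] have "(a \<bullet> a) / (C1 * norm a) \<le> 1" by simp
      then show ?thesis using p C1(1) by (simp add: power2_norm_eq_inner[symmetric] power2_eq_square)
    qed (use C1 in simp)
  qed
  obtain \<delta> :: real where \<delta>: "\<delta> > 0" "\<forall>a. (\<forall>v\<in>V. a \<bullet> v \<le> 1) \<longrightarrow>
    (\<exists>b. (\<forall>v\<in>V. b \<bullet> v \<le> 1) \<and> (\<forall>v\<in>V. a \<bullet> v > 1 - \<delta> \<longrightarrow> b \<bullet> v = 1))"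
    by (rule near_maximisers_exact[OF V(1) bd], rule that, assumption+)
  show ?thesis
  proof (intro exI[of _ "\<delta> / C"] conjI allI impI)
    show "\<delta> / C > 0" using \<delta> C by simp
    fix I :: "real set" and \<gamma> :: "real \<Rightarrow> 'a" and u :: "real \<Rightarrow> 'e"
    assume H: "is_interval I \<and> normal_curve G T A N I \<gamma> u \<and>
           0 < curve_length N I u \<and> curve_length N I u < ennreal (\<delta> / C)"
    then have I: "is_interval I" and nc: "normal_curve G T A N I \<gamma> u" by auto
    obtain l :: "'e \<Rightarrow> real" where l: "linear l"
      "AE t in lebesgue_on I. l \<circ> Ad G A (\<gamma> t) \<in> subdifferential (energy N) (u t)"
      using nc unfolding normal_curve_def by blast
    have ctl: "AE t in lebesgue_on I. \<exists>v. has_velocity A \<gamma> I t v \<and>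
        u t = tangent_map A A (\<lambda>x. inv\<^bsub>G\<^esub> (\<gamma> t) \<otimes>\<^bsub>G\<^esub> x) (\<gamma> t) v"
      using nc unfolding normal_curve_def has_control_def by blast
    obtain S1 where S1: "negligible S1" "\<And>t. t \<in> I - S1 \<Longrightarrow> l \<circ> Ad G A (\<gamma> t) \<in> subdifferential (energy N) (u t)"
      by (rule AE_lebesgue_on_exceptional_set[OF I l(2)], rule that, assumption+)
    obtain S2 where S2: "negligible S2" "\<And>t. t \<in> I - S2 \<Longrightarrow> \<exists>v. has_velocity A \<gamma> I t v \<and>
        u t = tangent_map A A (\<lambda>x. inv\<^bsub>G\<^esub> (\<gamma> t) \<otimes>\<^bsub>G\<^esub> x) (\<gamma> t) v"
      by (rule AE_lebesgue_on_exceptional_set[OF I ctl], rule that, assumption+)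
    interpret polyhedral_normal_curve G T A N V B I \<gamma> u l "S1 \<union> S2"
    proof (intro polyhedral_normal_curve.intro polyhedral_normal_curve_axioms.intro)
      show "finsler_lie_group G T A N" by fact
      show "abs_continuous_curve T A I \<gamma>" using nc by (simp add: normal_curve_def)
    qed (use V B I l S1 S2 in auto)
    show "takes_values_in_face N I u"
      using short_takes_values_in_face[OF BC C \<delta>] H by blast
  qed
qed

end
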